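(* Let $\textsc{UDP}(n,p)$ and $\textsc{DDP}(n,p)$ be the extremal functions defined in the context. Suppose that there are constants $\lambda,\mu>0$ such that $\textsc{UDP}(n,p)=O(n^{\lambda}p^{\mu}+n)$. Then $$\textsc{DDP}(n,p)=O\left(n^{\frac{1}{2-\lambda}}p^{\frac{1+\mu-\lambda}{2-\lambda}}+n^{1/2}p+n\right).$$
   Context: Graphs have nonnegative real edge weights. Given a graph $G$ and a set $P\subseteq V(G)\times V(G)$ of demand pairs such that $t$ is reachable from $s$ for every $(s,t)\in P$, an (exact) distance preserver of $G,P$ is a subgraph $H$ of $G$ with $\mathrm{dist}_H(s,t)=\mathrm{dist}_G(s,t)$ for all $(s,t)\in P$. $\textsc{UDP}(n,p)$ (resp. $\textsc{DDP}(n,p)$) denotes the maximum, over all $n$-node undirected (resp. directed) weighted graphs $G$ and all sets $P$ of $p$ demand pairs, of the minimum number of edges of an exact distance preserver of $G,P$.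
   Formalization: The formal theorem adds the assumption λ < 2: the exponents are undefined at λ = 2, and for λ > 2 the hypothesis on UDP holds trivially, since UDP(n,p) ≤ n², so the claim would no longer be a conditional transfer. *)

theory Defs
  imports
    "Graph_Theory.Pair_Digraph"
    "Graph_Theory.Digraph_Component"
    "Graph_Theory.Shortest_Path"
    "HOL-Library.Landau_Symbols"
begin

text \<open>
  Graphs are simple and finite, with vertices drawn from \<^typ>\<open>nat\<close> (no restriction up to
  isomorphism). As in Graph_Theory, an undirected graph is a symmetric digraph; each of its
  edges is thus represented by two opposite arcs, which must carry the same weight and which
  together count as one edge.
\<close>

type_synonym wt = "nat \<times> nat \<Rightarrow> real"

definition directed_instance :: "nat pair_pre_digraph \<Rightarrow> wt \<Rightarrow> bool" where
  "directed_instance G w \<longleftrightarrow> pair_digraph G \<and> (\<forall>e \<in> parcs G. 0 \<le> w e)"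

definition undirected_instance :: "nat pair_pre_digraph \<Rightarrow> wt \<Rightarrow> bool" where
  "undirected_instance G w \<longleftrightarrow> pair_graph G \<and> (\<forall>e \<in> parcs G. 0 \<le> w e) \<and>
     (\<forall>(u, v) \<in> parcs G. w (u, v) = w (v, u))"

definition demand_pairs :: "nat pair_pre_digraph \<Rightarrow> (nat \<times> nat) set \<Rightarrow> bool" where
  "demand_pairs G P \<longleftrightarrow> P \<subseteq> pverts G \<times> pverts G \<and> (\<forall>(s, t) \<in> P. s \<rightarrow>\<^sup>*\<^bsub>with_proj G\<^esub> t)"

text \<open>The distance is infinite if there is no walk, in particular if an endpoint is missing.\<close>

definition wdist :: "nat pair_pre_digraph \<Rightarrow> wt \<Rightarrow> nat \<Rightarrow> nat \<Rightarrow> ereal" where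
  "wdist G w s t = wf_digraph.\<mu> (with_proj G) w s t"

definition distance_preserver ::
  "nat pair_pre_digraph \<Rightarrow> wt \<Rightarrow> (nat \<times> nat) set \<Rightarrow> nat pair_pre_digraph \<Rightarrow> bool" where
  "distance_preserver G w P H \<longleftrightarrow> subgraph (with_proj H) (with_proj G) \<and>
     (\<forall>(s, t) \<in> P. wdist H w s t = wdist G w s t)"

definition undirected_edges :: "nat pair_pre_digraph \<Rightarrow> nat set set" where
  "undirected_edges G = {{u, v} | u v. (u, v) \<in> parcs G}"

definition min_directed_preserver :: "nat pair_pre_digraph \<Rightarrow> wt \<Rightarrow> (nat \<times> nat) set \<Rightarrow> nat" where
  "min_directed_preserver G w P = Min {card (parcs H) | H. distance_preserver G w P H}"

text \<open>A subgraph of an undirected graph is itself undirected, hence the symmetry condition.\<close>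

definition min_undirected_preserver :: "nat pair_pre_digraph \<Rightarrow> wt \<Rightarrow> (nat \<times> nat) set \<Rightarrow> nat" where
  "min_undirected_preserver G w P =
     Min {card (undirected_edges H) | H. distance_preserver G w P H \<and> symmetric (with_proj H)}"

definition DDP :: "nat \<Rightarrow> nat \<Rightarrow> nat" where
  "DDP n p = Max {min_directed_preserver G w P | G w P.
     directed_instance G w \<and> card (pverts G) = n \<and> demand_pairs G P \<and> card P = p}"

definition UDP :: "nat \<Rightarrow> nat \<Rightarrow> nat" where
  "UDP n p = Max {min_undirected_preserver G w P | G w P.
     undirected_instance G w \<and> card (pverts G) = n \<and> demand_pairs G P \<and> card P = p}"

text \<open>
  The pairs \<open>(n, p)\<close> with \<open>n, p \<ge> 1\<close> for which an instance exists. A bound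
  \<open>O[principal np_range]\<close> says that one constant works for all pairs in this range.
\<close>

definition np_range :: "(nat \<times> nat) set" where
  "np_range = {(n, p). 1 \<le> n \<and> 1 \<le> p \<and> p \<le> n\<^sup>2}"

text \<open>The minima and maxima above are attained.\<close>

lemma distance_preserver_refl:
  assumes "pair_wf_digraph G"
  shows "distance_preserver G w P G"
  using assms
  by (auto simp: distance_preserver_def subgraph_def compatible_def wf_digraph_wp_iff)

lemma card_parcs_le:
  assumes "pair_digraph G"
  shows "card (parcs G) \<le> card (pverts G) * card (pverts G)"
proof -
  interpret pair_digraph G by fact
  have "parcs G \<subseteq> pverts G \<times> pverts G" by (auto dest: wellformed')
  then have "card (parcs G) \<le> card (pverts G \<times> pverts G)"
    by (intro card_mono) auto
  then show ?thesis by (simp add: card_cartesian_product)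
qed

lemma undirected_edges_image: "undirected_edges G = (\<lambda>(u, v). {u, v}) ` parcs G"
  by (auto simp: undirected_edges_def)

lemma directed_preserver_sizes:
  fixes G :: "nat pair_pre_digraph" and w :: wt and P :: "(nat \<times> nat) set"
  assumes "pair_digraph G"
  defines "S \<equiv> {card (parcs H) | H. distance_preserver G w P H}"
  shows "finite S" "S \<noteq> {}" "min_directed_preserver G w P \<le> card (parcs G)"
proof -
  interpret pair_digraph G by fact
  have "S \<subseteq> {..card (parcs G)}"
    by (auto simp: S_def distance_preserver_def subgraph_def intro!: card_mono pair_finite_arcs)
  then show fin: "finite S" using finite_subset by blast
  have mem: "card (parcs G) \<in> S"
    unfolding S_def using distance_preserver_refl pair_wf_digraph by blast
  then show "S \<noteq> {}" by auto
  show "min_directed_preserver G w P \<le> card (parcs G)"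
    using Min_le[OF fin mem] by (simp add: min_directed_preserver_def S_def)
qed

lemma undirected_preserver_sizes:
  fixes G :: "nat pair_pre_digraph" and w :: wt and P :: "(nat \<times> nat) set"
  assumes "pair_graph G"
  defines "S \<equiv> {card (undirected_edges H) | H. distance_preserver G w P H \<and> symmetric (with_proj H)}"
  shows "finite S" "S \<noteq> {}" "min_undirected_preserver G w P \<le> card (parcs G)"
proof -
  interpret pair_graph G by fact
  have le: "card (undirected_edges H) \<le> card (parcs G)" if "parcs H \<subseteq> parcs G" for H
    using card_image_le[of "parcs H"] card_mono[OF pair_finite_arcs that]
      finite_subset[OF that pair_finite_arcs]
    unfolding undirected_edges_image by (meson le_trans)
  have "S \<subseteq> {..card (parcs G)}"
    by (auto simp: S_def distance_preserver_def subgraph_def intro!: le)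
  then show fin: "finite S" using finite_subset by blast
  have mem: "card (undirected_edges G) \<in> S"
    unfolding S_def using distance_preserver_refl pair_wf_digraph pair_sym_arcs by blast
  then show "S \<noteq> {}" by auto
  show "min_undirected_preserver G w P \<le> card (parcs G)"
    using Min_le[OF fin mem] le[of G] by (simp add: min_undirected_preserver_def S_def)
qed

lemma complete_instance:
  assumes "(n, p) \<in> np_range"
  obtains G P where "undirected_instance G (\<lambda>_. 1)" "directed_instance G (\<lambda>_. 1)"
    "card (pverts G) = n" "demand_pairs G P" "card P = p"
proof -
  define G :: "nat pair_pre_digraph" where
    "G = \<lparr>pverts = {..<n}, parcs = {(u, v). u < n \<and> v < n \<and> u \<noteq> v}\<rparr>"
  have arcs: "finite {(u, v). u < n \<and> v < n \<and> u \<noteq> v}"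
    by (rule finite_subset[of _ "{..<n} \<times> {..<n}"]) auto
  have pg: "pair_graph G"
    by unfold_locales (auto simp: G_def arcs symmetric_def sym_def)
  then interpret pair_graph G .
  have "p \<le> card ({..<n} \<times> {..<n})"
    using assms by (simp add: np_range_def power2_eq_square)
  then obtain P where P: "P \<subseteq> {..<n} \<times> {..<n}" "card P = p"
    by (metis obtain_subset_with_card_n)
  have reach: "s \<rightarrow>\<^sup>*\<^bsub>with_proj G\<^esub> t" if "s < n" "t < n" for s t
  proof (cases "s = t")
    case True
    then show ?thesis using that by (simp add: G_def reachable_def rtrancl_on.rtrancl_on_refl)
  next
    case False
    then have "(s, t) \<in> parcs G" using that by (simp add: G_def)
    then show ?thesis by (rule reachable_adjI)
  qed
  have "demand_pairs G P"
    using P(1) reach by (auto simp: demand_pairs_def G_def)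
  moreover have "undirected_instance G (\<lambda>_. 1)" "directed_instance G (\<lambda>_. 1)"
    using pg pair_digraph by (auto simp: undirected_instance_def directed_instance_def)
  ultimately show ?thesis using P(2) by (intro that[of G P]) (auto simp: G_def)
qed

lemma DDP_instances:
  defines "S \<equiv> \<lambda>n p. {min_directed_preserver G w P | G w P.
     directed_instance G w \<and> card (pverts G) = n \<and> demand_pairs G P \<and> card P = p}"
  shows "finite (S n p)" "(n, p) \<in> np_range \<Longrightarrow> S n p \<noteq> {}"
proof -
  have "S n p \<subseteq> {..n * n}"
    using directed_preserver_sizes(3) card_parcs_le
    by (fastforce simp: S_def directed_instance_def intro: le_trans)
  then show "finite (S n p)" using finite_subset by blast
  show "S n p \<noteq> {}" if r: "(n, p) \<in> np_range"
    by (rule complete_instance[OF r]) (use S_def in blast)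
qed

lemma UDP_instances:
  defines "S \<equiv> \<lambda>n p. {min_undirected_preserver G w P | G w P.
     undirected_instance G w \<and> card (pverts G) = n \<and> demand_pairs G P \<and> card P = p}"
  shows "finite (S n p)" "(n, p) \<in> np_range \<Longrightarrow> S n p \<noteq> {}"
proof -
  have "S n p \<subseteq> {..n * n}"
    using undirected_preserver_sizes(3) card_parcs_le pair_graph.axioms(1)
    by (fastforce simp: S_def undirected_instance_def intro: le_trans)
  then show "finite (S n p)" using finite_subset by blast
  show "S n p \<noteq> {}" if r: "(n, p) \<in> np_range"
    by (rule complete_instance[OF r]) (use S_def in blast)
qed

end

theory Submission
  imports Defs "HOL-Library.Nat_Bijection"
begin

text \<open>
  After a perturbation of the weights, shortest paths are unique. Cut the vertex set into sets \<open>Q\<close>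
  of \<open>l\<close> vertices that each lie on one shortest path, leaving fewer than \<open>l\<close> uncovered vertices per
  demand path. Whenever another demand path visits \<open>Q\<close> in forward direction, it follows the path of
  \<open>Q\<close>, so what is left of its trace on \<open>Q\<close> are jumps backwards, between consecutive record lows.
  The jumps form an acyclic graph on \<open>Q\<close>; with round-trip distances as weights it is an undirected
  instance with at most \<open>p\<close> demand pairs all of whose edges are needed, so there are at most
  \<open>UDP(l, p)\<close> jumps. By uniqueness of shortest paths, an arc of the preserver that enters \<open>Q\<close> is
  determined by a jump, or it is the first arc of its demand path into \<open>Q\<close>, or it is the arc of the
  path of \<open>Q\<close>. This gives \<open>p l + (n / l) (UDP(l, p) + p + l)\<close> arcs, and it remains to choose \<open>l\<close>.
\<close>

section \<open>Systems of unique geodesics\<close>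

text \<open>Picking one element from each nonempty \<open>F i\<close> covers the union. This turns
  "the arc is determined by this index" into a bound on the number of arcs.\<close>

lemma card_UN_le_of_singletons:
  assumes "finite I" "\<And>i a b. i \<in> I \<Longrightarrow> a \<in> F i \<Longrightarrow> b \<in> F i \<Longrightarrow> a = b"
  shows "finite (\<Union>i\<in>I. F i)" "card (\<Union>i\<in>I. F i) \<le> card I"
proof -
  have 1: "F i \<subseteq> {SOME a. a \<in> F i}" if "i \<in> I" for i
    using assms(2)[OF that] by (auto intro: someI2)
  then have sub: "(\<Union>i\<in>I. F i) \<subseteq> (\<lambda>i. SOME a. a \<in> F i) ` I" by blast
  show "finite (\<Union>i\<in>I. F i)" using sub assms(1) finite_subset by blast
  show "card (\<Union>i\<in>I. F i) \<le> card I"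
    using sub assms(1) by (meson card_image_le card_mono finite_imageI le_trans)
qed

text \<open>\<open>D\<close> is the distance for the weights \<open>c\<close>, and \<open>R\<close> is reachability; off \<open>R\<close> the values
  of \<open>D\<close> carry no meaning.\<close>

locale unique_geodesics =
  fixes V :: "nat set" and A :: "(nat \<times> nat) set" and c :: wt
    and D :: "nat \<Rightarrow> nat \<Rightarrow> real" and R :: "nat \<Rightarrow> nat \<Rightarrow> bool"
  assumes finite_V: "finite V"
    and arcs_V: "A \<subseteq> V \<times> V"
    and D_refl: "x \<in> V \<Longrightarrow> D x x = 0"
    and D_pos: "x \<in> V \<Longrightarrow> y \<in> V \<Longrightarrow> x \<noteq> y \<Longrightarrow> 0 < D x y"
    and D_triangle: "x \<in> V \<Longrightarrow> y \<in> V \<Longrightarrow> z \<in> V \<Longrightarrow> D x z \<le> D x y + D y z"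
    and D_arc: "(u, v) \<in> A \<Longrightarrow> D u v \<le> c (u, v)"
    and R_between: "s \<in> V \<Longrightarrow> v \<in> V \<Longrightarrow> t \<in> V \<Longrightarrow> R s t \<Longrightarrow> D s v + D v t = D s t \<Longrightarrow> R s v \<and> R v t"
    and linear: "s \<in> V \<Longrightarrow> t \<in> V \<Longrightarrow> R s t \<Longrightarrow> x \<in> V \<Longrightarrow> y \<in> V \<Longrightarrow>
      D s x + D x t = D s t \<Longrightarrow> D s y + D y t = D s t \<Longrightarrow> D s x + D x y = D s y \<or> D s y + D y x = D s x"
    and last_arc_ex: "x \<in> V \<Longrightarrow> y \<in> V \<Longrightarrow> R x y \<Longrightarrow> x \<noteq> y \<Longrightarrow> \<exists>u. (u, y) \<in> A \<and> D x u + c (u, y) = D x y"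
    and last_arc_unique: "x \<in> V \<Longrightarrow> R x y \<Longrightarrow> (u, y) \<in> A \<Longrightarrow> D x u + c (u, y) = D x y \<Longrightarrow>
      (u', y) \<in> A \<Longrightarrow> D x u' + c (u', y) = D x y \<Longrightarrow> u = u'"
begin

text \<open>A shortest path is represented by the vertices where the triangle inequality is tight,
  not by a walk; when \<open>R s t\<close> holds, \<open>linear\<close> lets the distance from
  \<open>s\<close> order them totally.\<close>

definition geodesic :: "nat \<times> nat \<Rightarrow> nat set" where
  "geodesic = (\<lambda>(s, t). {v \<in> V. D s v + D v t = D s t})"

definition geodesic_arcs :: "nat \<times> nat \<Rightarrow> (nat \<times> nat) set" where
  "geodesic_arcs = (\<lambda>(s, t). {(u, v) \<in> A. D s u + c (u, v) + D v t = D s t})"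

definition demands :: "(nat \<times> nat) set" where
  "demands = {(s, t). s \<in> V \<and> t \<in> V \<and> R s t}"

lemma D_nonneg: "x \<in> V \<Longrightarrow> y \<in> V \<Longrightarrow> 0 \<le> D x y"
  using D_refl D_pos by (metis order_less_imp_le order_refl)

lemma geodesic_in_V: "v \<in> geodesic st \<Longrightarrow> v \<in> V"
  by (auto simp: geodesic_def)

text \<open>\<open>linear\<close> offers two orders of \<open>x\<close> and \<open>y\<close>, and
  positivity of \<open>D y x\<close> excludes the wrong one. The other claims follow by the triangle
  inequality, \<open>R_between\<close> and positivity.\<close>

lemma geodesic_between:
  assumes st: "(s, t) \<in> demands" and x: "x \<in> geodesic (s, t)" and y: "y \<in> geodesic (s, t)"
    and le: "D s x \<le> D s y"
  shows "D s x + D x y = D s y" "D x y + D y t = D x t" "R x y" "D s x = D s y \<Longrightarrow> x = y"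
proof -
  have V: "s \<in> V" "t \<in> V" "R s t" "x \<in> V" "y \<in> V"
    using assms by (auto simp: demands_def geodesic_def)
  have b: "D s x + D x t = D s t" "D s y + D y t = D s t"
    using x y by (auto simp: geodesic_def)
  show 1: "D s x + D x y = D s y"
  proof (cases "x = y")
    case False
    have "\<not> D s y + D y x = D s x" using D_pos[of y x] V False le by auto
    then show ?thesis using linear[OF V(1-5) b] by auto
  qed (use D_refl V in auto)
  show 2: "D x y + D y t = D x t"
    using 1 b D_triangle[of x y t] V by auto
  show "R x y"
    using R_between[of s x t] R_between[of x y t] V b 2 by auto
  show "x = y" if "D s x = D s y"
    using that 1 D_pos[of x y] V by force
qed

text \<open>The chain \<open>s\<close>, \<open>x\<close>, \<open>z\<close>, \<open>y\<close>,
  \<open>t\<close> has total length \<open>D s t\<close>, so every triangle inequality along it is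
  tight. The condition on \<open>z\<close> mentions neither \<open>s\<close> nor \<open>t\<close>,
  which allows points to be moved between geodesics that share \<open>x\<close> and
  \<open>y\<close>.\<close>

lemma geodesic_convex:
  assumes st: "(s, t) \<in> demands" and x: "x \<in> geodesic (s, t)" and y: "y \<in> geodesic (s, t)"
    and le: "D s x \<le> D s y" and z: "z \<in> V" "D x z + D z y = D x y"
  shows "z \<in> geodesic (s, t)" "D s x \<le> D s z" "D s z \<le> D s y"
proof -
  have V: "s \<in> V" "t \<in> V" "R s t" "x \<in> V" "y \<in> V"
    using assms by (auto simp: demands_def geodesic_def)
  have b: "D s x + D x t = D s t" "D s y + D y t = D s t"
    using x y by (auto simp: geodesic_def)
  note 1 = geodesic_between(1)[OF st x y le]
  have "D s z \<le> D s x + D x z" "D s y \<le> D s z + D z y" "D z t \<le> D z y + D y t" "D s t \<le> D s z + D z t"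
    using D_triangle V z(1) by blast+
  moreover have "0 \<le> D x z" "0 \<le> D z y" using D_nonneg V z by auto
  ultimately show "z \<in> geodesic (s, t)" "D s x \<le> D s z" "D s z \<le> D s y"
    using z 1 b by (auto simp: geodesic_def)
qed

text \<open>In \<open>D s t <= D s v + D v t <= D s u + c (u, v) + D v t\<close> the two ends agree,
  so both steps are equalities.\<close>

lemma geodesic_arc_heads:
  assumes st: "(s, t) \<in> demands" and a: "(u, v) \<in> geodesic_arcs (s, t)"
  shows "(u, v) \<in> A" "u \<in> V" "v \<in> geodesic (s, t)" "D s u + c (u, v) = D s v"
proof -
  show A: "(u, v) \<in> A" using a by (auto simp: geodesic_arcs_def)
  then have V: "u \<in> V" "v \<in> V" "s \<in> V" "t \<in> V" using arcs_V st by (auto simp: demands_def)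
  then show "u \<in> V" by simp
  have "D s v \<le> D s u + c (u, v)" using D_triangle[of s u v] V D_arc[OF A] by simp
  moreover have "D s t \<le> D s v + D v t" using D_triangle V by blast
  ultimately show "v \<in> geodesic (s, t)" "D s u + c (u, v) = D s v"
    using a V by (auto simp: geodesic_arcs_def geodesic_def)
qed

text \<open>A tight last arc from \<open>x\<close> to \<open>v\<close> is also a tight last arc from
  \<open>s\<close> to \<open>v\<close>, where it is unique. Hence the arc entering \<open>v\<close>
  can be recovered from any earlier point of the geodesic.\<close>

lemma geodesic_arc_from:
  assumes st: "(s, t) \<in> demands" and a: "(u, v) \<in> geodesic_arcs (s, t)"
    and x: "x \<in> geodesic (s, t)" "D s x < D s v"
  shows "D x u + c (u, v) = D x v"
proof -
  note h = geodesic_arc_heads[OF st a]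
  have V: "s \<in> V" "t \<in> V" "R s t" "x \<in> V" "v \<in> V"
    using h x st by (auto simp: demands_def geodesic_def)
  have sxv: "D s x + D x v = D s v" "R x v"
    using geodesic_between[OF st x(1) h(3)] x(2) by auto
  have "R s v" using R_between[of s v t] h(3) V by (auto simp: geodesic_def)
  obtain u' where u': "(u', v) \<in> A" "D x u' + c (u', v) = D x v"
    using last_arc_ex[of x v] V sxv x by auto
  then have "u' \<in> V" using arcs_V by auto
  have "D s u' \<le> D s x + D x u'" "D s v \<le> D s u' + D u' v"
    using D_triangle V \<open>u' \<in> V\<close> by blast+
  then have "D s u' + c (u', v) = D s v" using u' sxv D_arc[OF u'(1)] by auto
  then have "u = u'" using last_arc_unique[OF V(1) \<open>R s v\<close> h(1,4) u'(1)] by auto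
  then show ?thesis using u' by simp
qed

lemma geodesic_arc_unique:
  assumes st: "(s, t) \<in> demands" and a: "(u, v) \<in> geodesic_arcs (s, t)" "(u', v) \<in> geodesic_arcs (s, t)"
  shows "u = u'"
proof -
  note h = geodesic_arc_heads[OF st a(1)] and h' = geodesic_arc_heads[OF st a(2)]
  have V: "s \<in> V" "t \<in> V" "R s t" "v \<in> V" using h st by (auto simp: demands_def geodesic_def)
  have "R s v" using R_between[of s v t] h(3) V by (auto simp: geodesic_def)
  then show ?thesis using last_arc_unique[OF V(1) _ h(1,4) h'(1,4)] by auto
qed

end

section \<open>Restricting to vertices of a single geodesic\<close>

text \<open>The greedy count takes \<open>Q\<close> from the vertices of a demand geodesic that are
  still left, so \<open>Q\<close> may have gaps.\<close>

locale geodesic_restriction = unique_geodesics +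
  fixes s0 t0 :: nat and Q :: "nat set" and P :: "(nat \<times> nat) set"
  assumes base: "(s0, t0) \<in> demands"
    and Q_geodesic: "Q \<subseteq> geodesic (s0, t0)"
    and P_demands: "P \<subseteq> demands" and finite_P: "finite P"
begin

section \<open>Record lows along a geodesic and the jumps between them\<close>

definition rk :: "nat \<Rightarrow> real" where "rk q = D s0 q"

definition record_at :: "nat \<times> nat \<Rightarrow> nat \<Rightarrow> bool" where
  "record_at st y \<longleftrightarrow> y \<in> Q \<inter> geodesic st \<and>
     (\<forall>x \<in> Q \<inter> geodesic st. D (fst st) x < D (fst st) y \<longrightarrow> rk y < rk x)"

text \<open>Adjacency is stated by rank alone; by \<open>record_less\<close> falling rank is the
  order of visit, so the two records are also consecutive along the geodesic.\<close>

definition next_record :: "nat \<times> nat \<Rightarrow> nat \<Rightarrow> nat \<Rightarrow> bool" where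
  "next_record st x y \<longleftrightarrow> record_at st x \<and> record_at st y \<and> rk y < rk x \<and>
     \<not> (\<exists>z. record_at st z \<and> rk y < rk z \<and> rk z < rk x)"

definition jumps :: "(nat \<times> nat) set" where
  "jumps = {(x, y). \<exists>st \<in> P. next_record st x y}"

text \<open>The round-trip distance is symmetric, and its geodesics between points of \<open>Q\<close> are forced to
  move monotonically along the base geodesic; this is what makes the undirected graph faithful.\<close>

definition roundtrip :: wt where
  "roundtrip = (\<lambda>(x, y). D x y + D y x)"

lemma Q_V: "x \<in> Q \<Longrightarrow> x \<in> V"
  using Q_geodesic geodesic_in_V by blast

lemma finite_Q: "finite Q"
  using Q_V finite_V by (meson finite_subset subsetI)

lemma Q_dist: "x \<in> Q \<Longrightarrow> y \<in> Q \<Longrightarrow> rk x \<le> rk y \<Longrightarrow> D x y = rk y - rk x"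
  using geodesic_between(1)[OF base, of x y] Q_geodesic by (force simp: rk_def)

lemma rk_inj: "x \<in> Q \<Longrightarrow> y \<in> Q \<Longrightarrow> rk x = rk y \<Longrightarrow> x = y"
  using geodesic_between(4)[OF base, of x y] Q_geodesic by (force simp: rk_def)

lemma recordD: "record_at st y \<Longrightarrow> y \<in> Q" "record_at st y \<Longrightarrow> y \<in> geodesic st" "record_at st y \<Longrightarrow> y \<in> V"
  by (auto simp: record_at_def Q_V)

text \<open>If \<open>y\<close> came first, the record property of \<open>x\<close> would force
  \<open>rk x < rk y\<close>; equal distances would force \<open>x = y\<close>.\<close>

lemma record_less:
  assumes st: "(s, t) \<in> demands" and r: "record_at (s, t) x" "record_at (s, t) y" "rk y < rk x"
  shows "D s x < D s y"
proof (rule ccontr)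
  assume "\<not> ?thesis"
  then have "D s y < D s x \<or> D s y = D s x" by auto
  then show False
    using r geodesic_between(4)[OF st, of y x] recordD(2)[OF r(1)] recordD(2)[OF r(2)]
    by (fastforce simp: record_at_def)
qed

lemma record_le:
  assumes st: "(s, t) \<in> demands" and r: "record_at (s, t) x" "record_at (s, t) y" "rk y \<le> rk x"
  shows "D s x \<le> D s y"
  using record_less[OF st r(1,2)] r rk_inj[of x y] recordD by (metis less_eq_real_def)

lemma jumps_D: "(x, y) \<in> jumps \<Longrightarrow> x \<in> Q" "(x, y) \<in> jumps \<Longrightarrow> y \<in> Q" "(x, y) \<in> jumps \<Longrightarrow> rk y < rk x"
  by (auto simp: jumps_def next_record_def dest: recordD)

lemma finite_records: "finite {z. record_at st z \<and> S z}"
  by (rule finite_subset[OF _ finite_Q]) (auto dest: recordD)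

lemma next_record_unique: "next_record st x y \<Longrightarrow> next_record st x z \<Longrightarrow> y = z"
  unfolding next_record_def using rk_inj recordD(1) by (metis linorder_neqE)

lemma next_record_ex:
  assumes "record_at st x" "record_at st b" "rk b < rk x"
  obtains y where "next_record st x y" "rk b \<le> rk y"
proof -
  let ?S = "{z. record_at st z \<and> rk z < rk x}"
  have "b \<in> ?S" "finite ?S" using assms finite_records by auto
  then have "Max (rk ` ?S) \<in> rk ` ?S" by (intro Max_in) auto
  then obtain y where y: "y \<in> ?S" "rk y = Max (rk ` ?S)" by auto
  have *: "rk z \<le> rk y" if "record_at st z" "rk z < rk x" for z using that y \<open>finite ?S\<close> by auto
  then have "\<not> (\<exists>z. record_at st z \<and> rk y < rk z \<and> rk z < rk x)"
    by (meson not_less)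
  moreover have "rk b \<le> rk y" using * assms by blast
  ultimately show ?thesis using that[of y] assms(1) y(1) unfolding next_record_def by blast
qed

lemma previous_record_ex:
  assumes "record_at st y" "record_at st a" "rk y < rk a"
  obtains x where "next_record st x y"
proof -
  let ?S = "{z. record_at st z \<and> rk y < rk z}"
  have "a \<in> ?S" "finite ?S" using assms finite_records by auto
  then have "Min (rk ` ?S) \<in> rk ` ?S" by (intro Min_in) auto
  then obtain x where x: "x \<in> ?S" "rk x = Min (rk ` ?S)" by auto
  have "rk x \<le> rk z" if "record_at st z" "rk y < rk z" for z using that x \<open>finite ?S\<close> by auto
  then have "\<not> (\<exists>z. record_at st z \<and> rk y < rk z \<and> rk z < rk x)" by (meson not_less)
  then show ?thesis using that[of x] assms(1) x(1) unfolding next_record_def by blast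
qed

text \<open>Both endpoints being met by the two geodesics, the geodesics coincide in between, so that
  they have the same records there.\<close>

lemma jump_next_record:
  assumes P: "(s, t) \<in> P" and x: "record_at (s, t) x" and j: "(x, z) \<in> jumps"
    and z: "z \<in> geodesic (s, t)" "D s x \<le> D s z"
  shows "next_record (s, t) x z"
proof -
  obtain s' t' where P': "(s', t') \<in> P" and nr: "next_record (s', t') x z" using j by (auto simp: jumps_def)
  have st: "(s, t) \<in> demands" and st': "(s', t') \<in> demands" using P P' P_demands by auto
  have rx: "record_at (s', t') x" and rz: "record_at (s', t') z" and rk: "rk z < rk x"
    using nr by (auto simp: next_record_def)
  note Q = recordD(1)[OF rx] recordD(1)[OF rz]
  have xz': "D s' x < D s' z" using record_less[OF st' rx rz rk] .
  have xz: "D s x < D s z" using z rk geodesic_between(4)[OF st _ z(1), of x] recordD(2)[OF x] by force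
  \<comment> \<open>The conclusion no longer mentions the endpoints \<open>a\<close> and
    \<open>b\<close>; with \<open>geodesic_convex\<close> it carries points between \<open>x\<close>
    and \<open>z\<close> from one demand to the other.\<close>
  have conv: "D x q + D q z = D x z \<and> D x q < D x z"
    if q: "q \<in> geodesic (a, b)" "(a, b) \<in> demands" "x \<in> geodesic (a, b)" "z \<in> geodesic (a, b)"
      "D a x \<le> D a q" "D a q < D a z" for a b q
  proof -
    have "D a x + D x q = D a q" "D a q + D q z = D a z" "D a x + D x z = D a z"
      using geodesic_between(1)[OF q(2,3,1)] geodesic_between(1)[OF q(2,1,4)] geodesic_between(1)[OF q(2,3,4)] q
      by auto
    then show ?thesis using q by auto
  qed
  \<comment> \<open>Points before \<open>x\<close> have rank above \<open>rk x\<close> because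
    \<open>x\<close> is a record; the remaining ones lie on the geodesic of \<open>(s', t')\<close>
    as well, where \<open>z\<close> is a record.\<close>
  have recz: "record_at (s, t) z"
    unfolding record_at_def
  proof (safe)
    fix q assume q: "q \<in> Q" "q \<in> geodesic (s, t)" "D (fst (s, t)) q < D (fst (s, t)) z"
    show "rk z < rk q"
    proof (cases "D s q < D s x")
      case True
      then show ?thesis using x q rk by (fastforce simp: record_at_def)
    next
      case False
      then have b: "D x q + D q z = D x z" "D x q < D x z"
        using conv[OF q(2) st] recordD(2)[OF x] z q by auto
      have g: "q \<in> geodesic (s', t')" "D s' q \<le> D s' z" "D s' x \<le> D s' q"
        using geodesic_convex[OF st' recordD(2)[OF rx] recordD(2)[OF rz] _ Q_V[OF q(1)] b(1)] xz' by auto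
      have "D s' q \<noteq> D s' z"
        using geodesic_between(4)[OF st' g(1) recordD(2)[OF rz]] b(2) by auto
      then show ?thesis using rz g q by (fastforce simp: record_at_def)
    qed
  qed (use Q z in auto)
  \<comment> \<open>If the next record \<open>y\<close> differed from \<open>z\<close>, it would
    also be a record of \<open>(s', t')\<close>, with rank strictly between those of
    \<open>z\<close> and \<open>x\<close>, against \<open>nr\<close>.\<close>
  show ?thesis
  proof (rule next_record_ex[OF x recz rk])
    fix y assume y: "next_record (s, t) x y" "rk z \<le> rk y"
    show ?thesis
    proof (cases "y = z")
      case False
      have ry: "record_at (s, t) y" "rk y < rk x" using y by (auto simp: next_record_def)
      note Qy = recordD(1)[OF ry(1)]
      have "rk z < rk y" using y False rk_inj[OF Q(2) Qy] by force
      have yz: "D s x < D s y" "D s y < D s z"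
        using record_less[OF st x ry] record_less[OF st ry(1) recz \<open>rk z < rk y\<close>] by auto
      have b: "D x y + D y z = D x z" "D x y < D x z"
        using conv[OF recordD(2)[OF ry(1)] st recordD(2)[OF x] z(1)] yz by auto
      have g: "y \<in> geodesic (s', t')" "D s' y \<le> D s' z" "D s' x \<le> D s' y"
        using geodesic_convex[OF st' recordD(2)[OF rx] recordD(2)[OF rz] _ Q_V[OF Qy] b(1)] xz' by auto
      have "record_at (s', t') y"
        unfolding record_at_def
      proof (safe)
        fix q assume q: "q \<in> Q" "q \<in> geodesic (s', t')" "D (fst (s', t')) q < D (fst (s', t')) y"
        show "rk y < rk q"
        proof (cases "D s' q < D s' x")
          case True
          then have "rk x < rk q" using rx q by (fastforce simp: record_at_def)
          then show ?thesis using ry by simp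
        next
          case False
          then have xq: "D s' x + D x q = D s' q" "D s' q + D q y = D s' y" "D s' x + D x y = D s' y"
            using geodesic_between(1)[OF st' recordD(2)[OF rx] q(2)]
             geodesic_between(1)[OF st' q(2) g(1)] geodesic_between(1)[OF st' recordD(2)[OF rx] g(1)] q g by auto
          then have b': "D x q + D q y = D x y" "D x q < D x y" using q by auto
          have g': "q \<in> geodesic (s, t)" "D s q \<le> D s y" "D s x \<le> D s q"
            using geodesic_convex[OF st recordD(2)[OF x] recordD(2)[OF ry(1)] _ Q_V[OF q(1)] b'(1)] yz by auto
          have "D s q \<noteq> D s y"
            using geodesic_between(4)[OF st g'(1) recordD(2)[OF ry(1)]] b'(2) by auto
          then show ?thesis using ry(1) g' q by (fastforce simp: record_at_def)
        qed
      qed (use Qy g in auto)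
      then show ?thesis using nr ry \<open>rk z < rk y\<close> by (auto simp: next_record_def)
    qed (use y in simp)
  qed
qed

section \<open>Round-trip distances and the undirected instance\<close>

lemma roundtrip_triangle:
  "x \<in> V \<Longrightarrow> y \<in> V \<Longrightarrow> z \<in> V \<Longrightarrow> roundtrip (x, z) \<le> roundtrip (x, y) + roundtrip (y, z)"
  using D_triangle[of x y z] D_triangle[of z y x] by (simp add: roundtrip_def)

text \<open>A tight round trip is tight in both directions. The way back from \<open>b\<close> to
  \<open>x\<close> follows the base geodesic and confines the rank of \<open>z\<close>; the way out
  puts \<open>z\<close> on the geodesic of the demand, so that \<open>jump_next_record\<close>
  applies.\<close>

lemma roundtrip_tight:
  assumes P: "(s, t) \<in> P" and x: "record_at (s, t) x" and b: "record_at (s, t) b" "rk b \<le> rk x"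
    and j: "(x, z) \<in> jumps \<or> (z, x) \<in> jumps"
    and tight: "roundtrip (x, z) + roundtrip (z, b) \<le> roundtrip (x, b)"
  shows "next_record (s, t) x z" "rk b \<le> rk z"
proof -
  have st: "(s, t) \<in> demands" using P P_demands by auto
  have Q: "x \<in> Q" "b \<in> Q" "z \<in> Q" using recordD(1) x b j jumps_D by blast+
  note V = Q[THEN Q_V]
  have "D x b \<le> D x z + D z b" "D b x \<le> D b z + D z x" using D_triangle V by blast+
  then have e: "D x z + D z b = D x b" "D b z + D z x = D b x"
    using tight by (auto simp: roundtrip_def)
  have bx: "D b x = rk x - rk b" using Q_dist Q b by auto
  have nn: "0 \<le> D b z" "0 \<le> D z x" using D_nonneg V by auto
  have "rk z \<le> rk x"
  proof (rule ccontr)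
    assume "\<not> ?thesis"
    then show False using Q_dist[OF Q(2,3)] b(2) e(2) bx nn by auto
  qed
  show "rk b \<le> rk z"
  proof (rule ccontr)
    assume "\<not> ?thesis"
    then show False using Q_dist[OF Q(3,1)] b(2) e(2) bx nn by auto
  qed
  \<comment> \<open>Jumps lower the rank, which settles the direction of the edge.\<close>
  have jz: "(x, z) \<in> jumps" using j \<open>rk z \<le> rk x\<close> jumps_D(3)[of z x] by auto
  show "next_record (s, t) x z"
    using jump_next_record[OF P x jz] geodesic_convex[OF st recordD(2)[OF x] recordD(2)[OF b(1)]
       record_le[OF st x b] V(3) e(1)] by auto
qed

definition restriction_graph :: "nat pair_pre_digraph" where
  "restriction_graph = \<lparr>pverts = Q, parcs = jumps \<union> jumps\<inverse>\<rparr>"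

lemma restriction_graph_simps[simp]:
  "pverts restriction_graph = Q" "parcs restriction_graph = jumps \<union> jumps\<inverse>"
  by (simp_all add: restriction_graph_def)

lemma finite_jumps: "finite jumps"
  by (rule finite_subset[of _ "Q \<times> Q"]) (auto dest: jumps_D simp: finite_Q)

lemma restriction_instance: "undirected_instance restriction_graph roundtrip"
proof -
  have "pair_graph restriction_graph"
    by unfold_locales
      (use finite_Q finite_jumps in \<open>auto dest: jumps_D simp: symmetric_def sym_def\<close>)
  moreover have "0 \<le> roundtrip e" if "e \<in> jumps \<union> jumps\<inverse>" for e
  proof -
    have "fst e \<in> V" "snd e \<in> V" using that jumps_D(1,2)[THEN Q_V] by (cases e; auto)+
    then show ?thesis using D_nonneg by (simp add: roundtrip_def case_prod_unfold)
  qed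
  ultimately show ?thesis by (auto simp: undirected_instance_def roundtrip_def)
qed

interpretation RG: pair_graph restriction_graph
  using restriction_instance by (simp add: undirected_instance_def)

lemma restriction_walk_ge:
  "RG.awalk x p b \<Longrightarrow> roundtrip (x, b) \<le> RG.awalk_cost roundtrip p"
proof (induction p arbitrary: x)
  case Nil
  then show ?case using D_refl Q_V by (auto simp: RG.awalk_Nil_iff roundtrip_def)
next
  case (Cons e p)
  obtain z where e: "e = (x, z)" "(x, z) \<in> jumps \<union> jumps\<inverse>" "RG.awalk z p b"
    using Cons.prems by (cases e) (auto simp: RG.awalk_Cons_iff)
  have "x \<in> V" "z \<in> V" using e(2) jumps_D Q_V by blast+
  moreover have "b \<in> V" using RG.awalk_last_in_verts[OF e(3)] Q_V by auto
  ultimately show ?case using Cons.IH[OF e(3)] roundtrip_triangle[of x z b] e(1) by auto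
qed

text \<open>Following the records adds up exactly: on the way out they lie on one demand geodesic,
  on the way back on the base geodesic. By \<open>restriction_walk_ge\<close> no walk is
  cheaper.\<close>

lemma restriction_walk_ex:
  assumes P: "(s, t) \<in> P" and b: "record_at (s, t) b"
  shows "record_at (s, t) x \<Longrightarrow> rk b \<le> rk x \<Longrightarrow> \<exists>p. RG.awalk x p b \<and> RG.awalk_cost roundtrip p = roundtrip (x, b)"
proof (induction "card {z. record_at (s, t) z \<and> rk z < rk x}" arbitrary: x rule: less_induct)
  case less
  have st: "(s, t) \<in> demands" using P P_demands by auto
  show ?case
  proof (cases "rk b = rk x")
    case True
    then have "x = b" using rk_inj less.prems b recordD by blast
    then show ?thesis using recordD[OF b] D_refl
      by (intro exI[of _ "[]"]) (auto simp: RG.awalk_Nil_iff roundtrip_def)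
  next
    case False
    then have "rk b < rk x" using less.prems by simp
    then obtain y where y: "next_record (s, t) x y" "rk b \<le> rk y"
      using next_record_ex less.prems b by blast
    then have ry: "record_at (s, t) y" "rk y < rk x" by (auto simp: next_record_def)
    have "card {z. record_at (s, t) z \<and> rk z < rk y} < card {z. record_at (s, t) z \<and> rk z < rk x}"
      by (rule psubset_card_mono[OF finite_records]) (use ry in force)
    then obtain p where p: "RG.awalk y p b" "RG.awalk_cost roundtrip p = roundtrip (y, b)"
      using less.hyps ry y by blast
    have "(x, y) \<in> jumps" using y P by (auto simp: jumps_def)
    then have "RG.awalk x ((x, y) # p) b" using p by (auto simp: RG.awalk_Cons_iff dest: jumps_D)
    moreover have "roundtrip (x, y) + roundtrip (y, b) = roundtrip (x, b)"
    proof -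
      have g: "x \<in> geodesic (s, t)" "y \<in> geodesic (s, t)" "b \<in> geodesic (s, t)"
        using ry b less.prems recordD by blast+
      have Q: "x \<in> Q" "y \<in> Q" "b \<in> Q" using ry b less.prems recordD by blast+
      have l: "D s x \<le> D s y" "D s y \<le> D s b" "D s x \<le> D s b"
        using record_le[OF st] ry y b less.prems by auto
      have "D x y + D y b = D x b"
        using geodesic_between(1)[OF st g(1,2)] geodesic_between(1)[OF st g(2,3)]
          geodesic_between(1)[OF st g(1,3)] l by auto
      moreover have "D b y + D y x = D b x" using Q_dist Q ry y by auto
      ultimately show ?thesis by (simp add: roundtrip_def)
    qed
    ultimately show ?thesis using p by (intro exI[of _ "(x, y) # p"]) auto
  qed
qed

text \<open>A walk that meets the lower bound has no slack at any step, so by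
  \<open>roundtrip_tight\<close> it always moves to the next record and traverses every adjacent
  pair on its way.\<close>

lemma restriction_walk_forced:
  assumes P: "(s, t) \<in> P" and b: "record_at (s, t) b"
    and yy: "next_record (s, t) y y'" "rk b \<le> rk y'"
  shows "RG.awalk x p b \<Longrightarrow> RG.awalk_cost roundtrip p \<le> roundtrip (x, b) \<Longrightarrow> record_at (s, t) x \<Longrightarrow>
    rk y \<le> rk x \<Longrightarrow> (y, y') \<in> set p"
proof (induction p arbitrary: x)
  case Nil
  then show ?case using yy by (auto simp: RG.awalk_Nil_iff next_record_def)
next
  case (Cons e p)
  obtain z where e: "e = (x, z)" "(x, z) \<in> jumps \<or> (z, x) \<in> jumps" "RG.awalk z p b"
    using Cons.prems by (cases e) (auto simp: RG.awalk_Cons_iff)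
  have "rk y' < rk y" using yy(1) by (auto simp: next_record_def)
  then have bx: "rk b \<le> rk x" using Cons.prems yy by auto
  have V: "x \<in> V" "z \<in> V" "b \<in> V" using e(2) jumps_D Q_V b recordD by blast+
  have tight: "roundtrip (x, z) + roundtrip (z, b) \<le> roundtrip (x, b)"
    using Cons.prems(2) restriction_walk_ge[OF e(3)] e(1) by auto
  note nr = roundtrip_tight[OF P Cons.prems(3) b bx e(2) tight]
  have "RG.awalk_cost roundtrip p \<le> roundtrip (z, b)"
    using Cons.prems(2) roundtrip_triangle[OF V] e(1) by auto
  moreover have "record_at (s, t) z" using nr by (auto simp: next_record_def)
  \<comment> \<open>No record has rank strictly between those of \<open>z\<close> and
    \<open>x\<close>, so the walk cannot skip \<open>y\<close>.\<close>
  moreover have "rk y \<le> rk z" if "y \<noteq> x"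
  proof -
    have "record_at (s, t) y" using yy by (simp add: next_record_def)
    then have "rk y < rk x" using that Cons.prems rk_inj[of y x] recordD(1) by force
    then show ?thesis using nr(1) \<open>record_at (s, t) y\<close> unfolding next_record_def by (meson not_less)
  qed
  moreover have "y' = z" if "y = x" using next_record_unique yy(1) nr(1) that by blast
  ultimately show ?case using Cons.IH[OF e(3)] e(1) by (cases "y = x") auto
qed

text \<open>These two records become the demand pair that stands for \<open>st\<close> in the
  undirected instance.\<close>

lemma extreme_records_ex:
  assumes "record_at st z"
  shows "\<exists>a b. record_at st a \<and> record_at st b \<and> (\<forall>z. record_at st z \<longrightarrow> rk b \<le> rk z \<and> rk z \<le> rk a)"
proof -
  have fin: "finite {z. record_at st z}" using finite_records[of st "\<lambda>_. True"] by simp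
  let ?I = "rk ` {z. record_at st z}"
  have "Max ?I \<in> ?I" "Min ?I \<in> ?I" using fin assms by (auto intro!: Max_in Min_in)
  then obtain a b where ab: "record_at st a" "record_at st b" "rk a = Max ?I" "rk b = Min ?I" by auto
  have "rk b \<le> rk z \<and> rk z \<le> rk a" if "record_at st z" for z
    using that fin by (auto simp: ab(3,4))
  then show ?thesis using ab by blast
qed

text \<open>\<open>H\<close> has a shortest walk from \<open>a\<close> to \<open>b\<close> of at
  most the round-trip cost. Seen in the restriction graph, it is forced through every adjacent pair
  of records.\<close>

lemma preserver_contains_jumps:
  assumes H: "distance_preserver restriction_graph roundtrip P' H"
    and P: "(s, t) \<in> P" and ab: "(a, b) \<in> P'" "record_at (s, t) a" "record_at (s, t) b"
      "\<And>z. record_at (s, t) z \<Longrightarrow> rk b \<le> rk z \<and> rk z \<le> rk a"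
    and yy: "next_record (s, t) y y'"
  shows "(y, y') \<in> parcs H"
proof -
  have sub: "subgraph (with_proj H) (with_proj restriction_graph)"
    using H by (simp add: distance_preserver_def)
  then interpret H: pair_wf_digraph H by (simp add: subgraph_def flip: wf_digraph_wp_iff)
  interpret H: fin_digraph "with_proj H"
    rewrites "verts H = pverts H" and "arcs H = parcs H"
    using sub RG.fin_digraph_axioms finite_Q finite_jumps
    by unfold_locales (auto simp: subgraph_def intro: finite_subset)
  obtain p where p: "RG.awalk a p b" "RG.awalk_cost roundtrip p = roundtrip (a, b)"
    using restriction_walk_ex[OF P ab(3,2)] ab by blast
  have "wdist H roundtrip a b = wdist restriction_graph roundtrip a b"
    using H ab(1) by (auto simp: distance_preserver_def)
  also have "\<dots> \<le> ereal (roundtrip (a, b))"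
    using RG.min_cost_le_walk_cost[OF p(1), of roundtrip] p(2) by (simp add: wdist_def)
  finally have le: "H.\<mu> roundtrip a b \<le> ereal (roundtrip (a, b))" by (simp add: wdist_def)
  then have "H.\<mu> roundtrip a b < \<infinity>" by auto
  then have "a \<rightarrow>\<^sup>*\<^bsub>with_proj H\<^esub> b" using H.\<mu>_reach_conv by blast
  moreover have "0 \<le> roundtrip e" if "e \<in> parcs H" for e
    using that sub restriction_instance by (auto simp: subgraph_def undirected_instance_def)
  ultimately obtain q where q: "H.apath a q b" "H.\<mu> roundtrip a b = H.awalk_cost roundtrip q"
    using H.min_cost_awalk by blast
  then have w: "H.awalk a q b" by (simp add: H.apath_def)
  have "RG.awalk a q b" using RG.subgraph_awalk_imp_awalk[OF w sub] .
  moreover have "RG.awalk_cost roundtrip q \<le> roundtrip (a, b)" using q le by simp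
  moreover have "rk y \<le> rk a" "rk b \<le> rk y'" using ab(4) yy by (auto simp: next_record_def)
  ultimately have "(y, y') \<in> set q"
    using restriction_walk_forced[OF P ab(3) yy] ab(2) by blast
  then show ?thesis using w by (auto simp: H.awalk_def)
qed

text \<open>Demands may share their extreme records or miss \<open>Q\<close>, so \<open>p'\<close>
  can be smaller than \<open>card P\<close>. It is kept as a witness; monotonicity is later applied
  to the assumed bound instead of \<open>UDP\<close>. A jump guarantees
  \<open>1 <= p'\<close>.\<close>

lemma card_jumps_le_UDP:
  assumes "jumps \<noteq> {}"
  obtains p' where "(card Q, p') \<in> np_range" "p' \<le> card P" "card jumps \<le> UDP (card Q) p'"
proof -
  define P0 where "P0 = {st \<in> P. \<exists>z. record_at st z}"
  define ends where "ends st ab \<longleftrightarrow> record_at st (fst ab) \<and> record_at st (snd ab) \<and>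
      (\<forall>z. record_at st z \<longrightarrow> rk (snd ab) \<le> rk z \<and> rk z \<le> rk (fst ab))" for st ab
  have "\<exists>ab. ends st ab" if st: "st \<in> P0" for st
  proof -
    obtain z where "record_at st z" using st by (auto simp: P0_def)
    from extreme_records_ex[OF this] show ?thesis by (auto simp: ends_def)
  qed
  then obtain f where f: "\<And>st. st \<in> P0 \<Longrightarrow> ends st (f st)"
    using bchoice[of P0 ends] by blast
  note f = f[unfolded ends_def]
  define P' where "P' = f ` P0"
  have finP0: "finite P0" using finite_P by (simp add: P0_def)
  have "card P' \<le> card P0" unfolding P'_def by (rule card_image_le[OF finP0])
  also have "\<dots> \<le> card P" unfolding P0_def by (rule card_mono[OF finite_P]) auto
  finally have cP: "card P' \<le> card P" .
  have subQ: "P' \<subseteq> Q \<times> Q"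
    unfolding P'_def using f recordD(1) by (metis image_subsetI mem_Times_iff)
  have "P0 \<noteq> {}" using assms by (auto simp: jumps_def next_record_def P0_def)
  then have "P' \<noteq> {}" by (simp add: P'_def)
  have "card P' \<le> (card Q)\<^sup>2"
    using card_mono[OF _ subQ] finite_Q by (simp add: power2_eq_square card_cartesian_product)
  moreover have "1 \<le> card P'" using \<open>P' \<noteq> {}\<close> finP0 by (simp add: P'_def Suc_le_eq card_gt_0_iff)
  moreover have "1 \<le> card Q" using subQ \<open>P' \<noteq> {}\<close> finite_Q by (auto simp: Suc_le_eq card_gt_0_iff)
  ultimately have range: "(card Q, card P') \<in> np_range" by (simp add: np_range_def)
  have "a \<rightarrow>\<^sup>*\<^bsub>with_proj restriction_graph\<^esub> b" if "(a, b) \<in> P'" for a b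
  proof -
    have "\<exists>st\<in>P0. (a, b) = f st" using that by (simp add: P'_def image_iff)
    then obtain st where st: "st \<in> P0" "f st = (a, b)" by metis
    then have "(fst st, snd st) \<in> P" "record_at (fst st, snd st) a" "record_at (fst st, snd st) b" "rk b \<le> rk a"
      using f[OF st(1)] by (auto simp: P0_def)
    then show ?thesis using restriction_walk_ex RG.reachable_awalkI by meson
  qed
  then have dem: "demand_pairs restriction_graph P'"
    using subQ by (auto simp: demand_pairs_def)
  have ge: "card jumps \<le> card (undirected_edges H)"
    if H: "distance_preserver restriction_graph roundtrip P' H" for H
  proof -
    have "jumps \<subseteq> parcs H"
    proof clarify
      fix y y' assume "(y, y') \<in> jumps"
      then obtain s t where st: "(s, t) \<in> P" "next_record (s, t) y y'" by (auto simp: jumps_def)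
      then have P0: "(s, t) \<in> P0" by (auto simp: P0_def next_record_def)
      show "(y, y') \<in> parcs H"
        using preserver_contains_jumps[OF H st(1) _ _ _ _ st(2), of "fst (f (s, t))" "snd (f (s, t))"]
          f[OF P0] P0 by (auto simp: P'_def)
    qed
    then have "(\<lambda>(u, v). {u, v}) ` jumps \<subseteq> undirected_edges H"
      by (auto simp: undirected_edges_image)
    moreover have "parcs H \<subseteq> parcs restriction_graph"
      using H by (auto simp: distance_preserver_def subgraph_def)
    then have "finite (undirected_edges H)"
      unfolding undirected_edges_image using RG.pair_finite_arcs finite_subset by blast
    \<comment> \<open>Ranks fall along jumps, so the reverse of a jump is not a jump and no edge is
      counted twice.\<close>
    moreover have "inj_on (\<lambda>(u, v). {u, v}) jumps"
      by (auto simp: inj_on_def doubleton_eq_iff) (meson jumps_D(3) less_asym)+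
    ultimately show ?thesis by (metis card_image card_mono)
  qed
  have "card jumps \<le> min_undirected_preserver restriction_graph roundtrip P'"
    unfolding min_undirected_preserver_def
    using undirected_preserver_sizes(1,2)[OF RG.pair_graph, of roundtrip P'] ge
    by (subst Min_ge_iff) auto
  also have "\<dots> \<le> UDP (card Q) (card P')"
    unfolding UDP_def
    by (rule Max_ge[OF UDP_instances(1)])
      (use restriction_instance dem restriction_graph_simps(1) in \<open>intro CollectI exI conjI; simp\<close>)
  finally show ?thesis using that range cP by blast
qed

section \<open>Arcs entering \<open>Q\<close>\<close>

text \<open>Each arc into \<open>v\<close> is a tight last arc from one of three sources:
  \<open>s0\<close> (\<open>T1\<close>), the start of a demand that first meets \<open>Q\<close> in
  \<open>v\<close> (\<open>T2\<close>), or the record before \<open>v\<close> (\<open>T3\<close>).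
  In each case uniqueness of last arcs leaves one candidate.\<close>

lemma card_arcs_into_Q:
  "card {(u, v) \<in> \<Union>(geodesic_arcs ` P). v \<in> Q} \<le> card jumps + card P + card Q"
proof -
  define T1 where "T1 v = {(u, v') \<in> A. v' = v \<and> D s0 u + c (u, v) = D s0 v}" for v
  define T2 where "T2 st = {(u, v) \<in> geodesic_arcs st. v \<in> Q \<and> (\<forall>x \<in> Q \<inter> geodesic st. D (fst st) v \<le> D (fst st) x)}" for st
  define T3 where "T3 xv = {(u, v) \<in> A. v = snd xv \<and> D (fst xv) u + c (u, v) = D (fst xv) v}" for xv
  have T1: "finite (\<Union>v\<in>Q. T1 v) \<and> card (\<Union>v\<in>Q. T1 v) \<le> card Q"
  proof (intro conjI card_UN_le_of_singletons[OF finite_Q])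
    fix v a b assume v: "v \<in> Q" "a \<in> T1 v" "b \<in> T1 v"
    have "R s0 v" using R_between[of s0 v t0] v Q_geodesic base by (auto simp: demands_def geodesic_def)
    then show "a = b" "a = b" using v last_arc_unique[of s0 v] base by (auto simp: T1_def demands_def)
  qed
  have T2: "finite (\<Union>st\<in>P. T2 st) \<and> card (\<Union>st\<in>P. T2 st) \<le> card P"
  proof (intro conjI card_UN_le_of_singletons[OF finite_P])
    fix st a b assume v: "st \<in> P" "a \<in> T2 st" "b \<in> T2 st"
    obtain s t u v u' v' where st: "st = (s, t)" "a = (u, v)" "b = (u', v')" by (metis surj_pair)
    then have d: "(s, t) \<in> demands" and arcs: "(u, v) \<in> geodesic_arcs (s, t)" "(u', v') \<in> geodesic_arcs (s, t)"
      using v P_demands by (auto simp: T2_def)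
    have g: "v \<in> geodesic (s, t)" "v' \<in> geodesic (s, t)" using geodesic_arc_heads(3)[OF d] arcs by auto
    then have "D s v = D s v'" using v st by (force simp: T2_def)
    then have "v = v'" using geodesic_between(4)[OF d g] by simp
    then show "a = b" "a = b" using geodesic_arc_unique[OF d] arcs st by auto
  qed
  have T3: "finite (\<Union>xv\<in>jumps. T3 xv) \<and> card (\<Union>xv\<in>jumps. T3 xv) \<le> card jumps"
  proof (intro conjI card_UN_le_of_singletons[OF finite_jumps])
    fix xv a b assume v: "xv \<in> jumps" "a \<in> T3 xv" "b \<in> T3 xv"
    obtain x v where xv: "xv = (x, v)" by (metis surj_pair)
    then obtain s t where st: "(s, t) \<in> P" "next_record (s, t) x v" using v by (auto simp: jumps_def)
    then have d: "(s, t) \<in> demands" using P_demands by auto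
    have rec: "record_at (s, t) x" "record_at (s, t) v" "rk v < rk x" using st by (auto simp: next_record_def)
    have "R x v" using geodesic_between(3)[OF d recordD(2)[OF rec(1)] recordD(2)[OF rec(2)]]
      record_less[OF d rec] by auto
    then show "a = b" "a = b" using v last_arc_unique[of x v] recordD(3)[OF rec(1)] xv by (auto simp: T3_def)
  qed
  have "{(u, v) \<in> \<Union>(geodesic_arcs ` P). v \<in> Q} \<subseteq> (\<Union>xv\<in>jumps. T3 xv) \<union> (\<Union>st\<in>P. T2 st) \<union> (\<Union>v\<in>Q. T1 v)"
  proof clarify
    fix u v s t
    assume P: "(s, t) \<in> P" and arc: "(u, v) \<in> geodesic_arcs (s, t)" and v: "v \<in> Q"
      and n: "(u, v) \<notin> (\<Union>v\<in>Q. T1 v)" "(u, v) \<notin> (\<Union>st\<in>P. T2 st)"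
    have d: "(s, t) \<in> demands" using P P_demands by auto
    note h = geodesic_arc_heads[OF d arc]
    obtain x where x: "x \<in> Q \<inter> geodesic (s, t)" "D s x < D s v"
      using n(2) P arc v by (force simp: T2_def not_le)
    \<comment> \<open>Otherwise some \<open>y\<close> precedes \<open>v\<close> on both the demand
      and the base geodesic. The arc is tight from \<open>y\<close>, hence from \<open>s0\<close>,
      and belongs to \<open>T1\<close>.\<close>
    have rec: "record_at (s, t) v"
    proof (rule ccontr)
      assume "\<not> ?thesis"
      then obtain y where y: "y \<in> Q" "y \<in> geodesic (s, t)" "D s y < D s v" "rk y \<le> rk v"
        using v h(3) by (auto simp: record_at_def not_less)
      have "D y u + c (u, v) = D y v" by (rule geodesic_arc_from[OF d arc y(2,3)])
      moreover have "D y v = D s0 v - D s0 y" using Q_dist[OF y(1) v y(4)] by (simp add: rk_def)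
      moreover have V: "s0 \<in> V" "y \<in> V" "v \<in> V" using base y v Q_V by (auto simp: demands_def)
      then have "D s0 u \<le> D s0 y + D y u" "D s0 v \<le> D s0 u + D u v" using D_triangle h(2) by blast+
      ultimately have "D s0 u + c (u, v) = D s0 v" using D_arc[OF h(1)] by auto
      then show False using n(1) v h(1) by (auto simp: T1_def)
    qed
    \<comment> \<open>The earliest vertex of \<open>Q\<close> on the geodesic is vacuously a record,
      so the later record \<open>v\<close> has a predecessor.\<close>
    let ?I = "Q \<inter> geodesic (s, t)"
    obtain a where a: "a \<in> ?I" "\<And>y. y \<in> ?I \<Longrightarrow> D s a \<le> D s y"
      using ex_min_if_finite[of "D s ` ?I"] finite_Q x by (auto simp: not_less image_iff)
    have "record_at (s, t) a" using a by (force simp: record_at_def)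
    moreover have "rk v < rk a" using rec a(1) a(2)[OF x(1)] x by (auto simp: record_at_def)
    ultimately obtain y where y: "next_record (s, t) y v" using previous_record_ex[OF rec] by blast
    then have "D y u + c (u, v) = D y v"
      using geodesic_arc_from[OF d arc, of y] record_less[OF d _ rec, of y] recordD(2)[of "(s, t)" y]
      by (auto simp: next_record_def)
    moreover have "(y, v) \<in> jumps" using y P by (auto simp: jumps_def)
    ultimately show "(u, v) \<in> (\<Union>xv\<in>jumps. T3 xv)" using h(1) by (force simp: T3_def)
  qed
  then have "card {(u, v) \<in> \<Union>(geodesic_arcs ` P). v \<in> Q}
      \<le> card ((\<Union>xv\<in>jumps. T3 xv) \<union> (\<Union>st\<in>P. T2 st) \<union> (\<Union>v\<in>Q. T1 v))"
    using T1 T2 T3 by (intro card_mono) auto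
  also have "\<dots> \<le> card (\<Union>xv\<in>jumps. T3 xv) + card (\<Union>st\<in>P. T2 st) + card (\<Union>v\<in>Q. T1 v)"
    by (meson add_le_cancel_right card_Un_le le_trans)
  finally show ?thesis using T1 T2 T3 by linarith
qed

end

section \<open>Perturbing the weights\<close>

text \<open>A path visits \<open>u\<close> only at its start, so its first arc can be read off from
  the arc set; the tail follows by induction.\<close>

lemma (in pair_fin_digraph) apath_determined_by_arcs:
  "apath u p v \<Longrightarrow> apath u q v \<Longrightarrow> set p = set q \<Longrightarrow> p = q"
proof (induction p arbitrary: u q)
  case Nil
  then show ?case by simp
next
  case (Cons e p)
  then obtain e' q' where q: "q = e' # q'" by (cases q) auto
  have ap: "fst e = u" "apath (snd e) p v" "u \<notin> set (awalk_verts (snd e) p)"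
    using Cons.prems(1) by (auto simp: apath_Cons_iff)
  have aq: "fst e' = u" "apath (snd e') q' v" "u \<notin> set (awalk_verts (snd e') q')"
    using Cons.prems(2) q by (auto simp: apath_Cons_iff)
  have tails: "fst d \<in> set (awalk_verts x r)" if "d \<in> set r" "apath x r v" for d x r
    using that by (metis apath_def awalk_verts_arc1 awalk_verts_with_proj_eq)
  have "e' \<notin> set p" using tails ap aq(1) by metis
  then have "e = e'" using Cons.prems(3) q by auto
  have "e \<notin> set p" "e \<notin> set q'" using tails ap aq \<open>e = e'\<close> by metis+
  then have "set p = set q'" using Cons.prems(3) q \<open>e = e'\<close> by auto
  then show ?case using Cons.IH ap aq q \<open>e = e'\<close> by auto
qed

text \<open>Adding \<open>\<delta> 2\<^sup>i\<close> to the weight of the \<open>i\<close>-th arc, for small \<open>\<delta>\<close>, breaks ties, as different arc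
  sets get different sums of powers of two.\<close>

lemma (in pair_fin_digraph) perturbation:
  fixes w :: "'a \<times> 'a \<Rightarrow> real"
  assumes w: "\<And>e. e \<in> parcs G \<Longrightarrow> 0 \<le> w e"
  obtains c where "\<And>e. e \<in> parcs G \<Longrightarrow> 0 < c e"
    "\<And>u p v. awalk u p v \<Longrightarrow> ereal (awalk_cost c p) = \<mu> c u v \<Longrightarrow> ereal (awalk_cost w p) = \<mu> w u v"
    "\<And>u p q v. awalk u p v \<Longrightarrow> awalk u q v \<Longrightarrow> ereal (awalk_cost c p) = \<mu> c u v \<Longrightarrow>
      ereal (awalk_cost c q) = \<mu> c u v \<Longrightarrow> p = q"
proof -
  obtain idx :: "'a \<times> 'a \<Rightarrow> nat" where idx: "inj_on idx (parcs G)"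
    using finite_imp_inj_to_nat_seg[OF pair_finite_arcs] by blast
  define b where "b e = (2::real) ^ idx e" for e
  have b_set: "awalk_cost b p = real (set_encode (idx ` set p))" if "distinct p" "set p \<subseteq> parcs G" for p
    using that
  proof (induction p)
    case (Cons e p)
    then have "idx e \<notin> idx ` set p" using idx by (auto simp: inj_on_def)
    then show ?case using Cons by (simp add: b_def set_encode_insert)
  qed simp
  \<comment> \<open>There are only finitely many paths, so a single \<delta> serves all strict
    comparisons between them.\<close>
  define F where "F = {p. \<exists>u v. apath u p v}"
  have "F \<subseteq> (\<lambda>(u, p, v). p) ` {(u, p, v). apath u p v}" by (force simp: F_def)
  then have finF: "finite F" using apaths_finite_triple finite_subset by blast
  define c where "c \<delta> e = w e + \<delta> * b e" for \<delta> e
  have cost: "awalk_cost (c \<delta>) p = awalk_cost w p + \<delta> * awalk_cost b p" for \<delta> p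
    by (induction p) (auto simp: c_def algebra_simps)
  have "\<forall>\<^sub>F \<delta> in at_right 0. awalk_cost w p < awalk_cost w q \<longrightarrow> awalk_cost (c \<delta>) p < awalk_cost (c \<delta>) q" for p q
  proof (cases "awalk_cost w p < awalk_cost w q")
    case True
    have "((\<lambda>\<delta>. awalk_cost w r + \<delta> * awalk_cost b r) \<longlongrightarrow> awalk_cost w r + 0 * awalk_cost b r) (at_right 0)" for r
      by (intro tendsto_intros)
    then have "((\<lambda>\<delta>. awalk_cost (c \<delta>) r) \<longlongrightarrow> awalk_cost w r) (at_right 0)" for r
      by (simp add: cost)
    from order_tendstoD[OF tendsto_diff[OF this this, of q p], of 0] True
    show ?thesis by (auto elim: eventually_mono)
  qed simp
  then have "\<forall>\<^sub>F \<delta> in at_right 0. \<forall>p\<in>F. \<forall>q\<in>F. awalk_cost w p < awalk_cost w q \<longrightarrow> awalk_cost (c \<delta>) p < awalk_cost (c \<delta>) q"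
    by (intro eventually_ball_finite finF ballI)
  moreover have "\<forall>\<^sub>F \<delta>::real in at_right 0. 0 < \<delta>" by (simp add: eventually_at_right_less)
  ultimately have "\<forall>\<^sub>F \<delta> in at_right 0. (\<forall>p\<in>F. \<forall>q\<in>F. awalk_cost w p < awalk_cost w q \<longrightarrow>
      awalk_cost (c \<delta>) p < awalk_cost (c \<delta>) q) \<and> 0 < \<delta>"
    by (rule eventually_conj)
  from eventually_happens[OF this] obtain \<delta> where \<delta>: "0 < \<delta>"
    and mono: "\<And>p q. p \<in> F \<Longrightarrow> q \<in> F \<Longrightarrow> awalk_cost w p < awalk_cost w q \<Longrightarrow>
      awalk_cost (c \<delta>) p < awalk_cost (c \<delta>) q"
    by (auto simp: trivial_limit_at_right_real)
  have pos: "0 < c \<delta> e" if "e \<in> parcs G" for e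
    using w[OF that] \<delta> by (simp add: c_def b_def add_nonneg_pos)
  have cost_pos: "0 < awalk_cost (c \<delta>) p" if w: "awalk u p v" "p \<noteq> []" for u p v
  proof -
    obtain e p' where p: "p = e # p'" using w by (cases p) auto
    then have "e \<in> parcs G" "awalk (snd e) p' v" using w by (auto simp: awalk_Cons_iff)
    then show ?thesis using pos pos_cost_pos_awalk_cost[of "snd e" p' v "c \<delta>"] p
      by (simp add: add_pos_nonneg less_imp_le)
  qed
  \<comment> \<open>Cutting out a cycle would save its positive cost.\<close>
  have opt_apath: "apath u p v" if p: "awalk u p v" "ereal (awalk_cost (c \<delta>) p) = \<mu> (c \<delta>) u v" for u p v
  proof (rule ccontr)
    assume "\<not> ?thesis"
    then have "\<not> distinct (pawalk_verts u p)" using p by (auto simp: apath_def)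
    then obtain q r s x where qrs: "p = q @ r @ s" "awalk u q x" "awalk x r x" "r \<noteq> []" "awalk x s v"
      using awalk_not_distinct_decomp[OF p(1), unfolded length_greater_0_conv] by metis
    then have "awalk u (q @ s) v" by (blast intro: awalk_appendI)
    then have "ereal (awalk_cost (c \<delta>) p) \<le> awalk_cost (c \<delta>) (q @ s)"
      using min_cost_le_walk_cost p(2) by metis
    then show False using cost_pos[OF qrs(3,4)] qrs(1) by simp
  qed
  \<comment> \<open>Were \<open>p\<close> dearer than a \<open>w\<close>-cheapest path, it would
    stay dearer after the perturbation.\<close>
  have w_opt: "ereal (awalk_cost w p) = \<mu> w u v"
    if p: "awalk u p v" "ereal (awalk_cost (c \<delta>) p) = \<mu> (c \<delta>) u v" for u p v
  proof -
    obtain q where q: "apath u q v" "\<mu> w u v = awalk_cost w q"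
      using min_cost_awalk[OF reachable_awalkI[OF p(1)], of w] w by auto
    have "ereal (awalk_cost (c \<delta>) p) \<le> ereal (awalk_cost (c \<delta>) q)"
      unfolding p(2) using min_cost_le_walk_cost q(1) by (simp add: apath_def)
    then have "awalk_cost (c \<delta>) p \<le> awalk_cost (c \<delta>) q" by simp
    moreover have "p \<in> F" "q \<in> F" using opt_apath[OF p] q by (auto simp: F_def)
    ultimately have "awalk_cost w p \<le> awalk_cost w q" using mono[of q p] by (meson not_less)
    then show ?thesis using q(2) min_cost_le_walk_cost[OF p(1), of w] by (simp add: antisym)
  qed
  \<comment> \<open>Old and new costs agree, which leaves equal sums of powers of two and hence
    equal arc sets.\<close>
  have uniq: "p = q" if "awalk u p v" "awalk u q v" "ereal (awalk_cost (c \<delta>) p) = \<mu> (c \<delta>) u v"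
    "ereal (awalk_cost (c \<delta>) q) = \<mu> (c \<delta>) u v" for u p q v
  proof -
    have ap: "apath u p v" "apath u q v" using opt_apath that by auto
    have "awalk_cost w p = awalk_cost w q" "awalk_cost (c \<delta>) p = awalk_cost (c \<delta>) q"
      using that w_opt by (metis ereal.inject)+
    then have eq: "awalk_cost b p = awalk_cost b q" using \<delta> by (simp add: cost)
    have "distinct p" "distinct q"
      using ap distinct_verts_imp_distinct by (auto simp: apath_def)
    moreover have sub: "set p \<subseteq> parcs G" "set q \<subseteq> parcs G" using that by auto
    ultimately have "set_encode (idx ` set p) = set_encode (idx ` set q)" using eq b_set by simp
    then have "idx ` set p = idx ` set q" by (simp add: set_encode_eq)
    then have "set p = set q" using sub idx by (simp add: inj_on_image_eq_iff)
    then show ?thesis using apath_determined_by_arcs ap by simp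
  qed
  show ?thesis
    by (rule that[of "c \<delta>"]) (fact pos w_opt uniq)+
qed

text \<open>The preserver keeps the arcs of the \<open>c\<close>-geodesics of the demands. Shortest
  walks for \<open>c\<close> survive in it and are shortest for \<open>w\<close> too.\<close>

lemma unique_geodesics_exist:
  assumes G: "directed_instance G w" and P: "demand_pairs G P"
  obtains c D where
    "unique_geodesics (pverts G) (parcs G) c D (\<lambda>x y. x \<rightarrow>\<^sup>*\<^bsub>with_proj G\<^esub> y)"
    "distance_preserver G w P \<lparr>pverts = pverts G, parcs = \<Union>(unique_geodesics.geodesic_arcs (parcs G) c D ` P)\<rparr>"
proof -
  interpret pair_digraph G using G by (simp add: directed_instance_def)
  have w: "0 \<le> w e" if "e \<in> parcs G" for e using that G by (simp add: directed_instance_def)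
  obtain c where c: "\<And>e. e \<in> parcs G \<Longrightarrow> 0 < c e"
    and c_w: "\<And>u p v. awalk u p v \<Longrightarrow> ereal (awalk_cost c p) = \<mu> c u v \<Longrightarrow> ereal (awalk_cost w p) = \<mu> w u v"
    and c_uniq: "\<And>u p q v. awalk u p v \<Longrightarrow> awalk u q v \<Longrightarrow> ereal (awalk_cost c p) = \<mu> c u v \<Longrightarrow>
      ereal (awalk_cost c q) = \<mu> c u v \<Longrightarrow> p = q"
    using perturbation[of w] w by blast
  define R where "R x y \<longleftrightarrow> x \<rightarrow>\<^sup>*\<^bsub>with_proj G\<^esub> y" for x y
  define d where "d x y = real_of_ereal (\<mu> c x y)" for x y
  \<comment> \<open>Unreachable pairs are put at a common distance \<open>B\<close> exceeding all others: this keeps \<open>D\<close> real-valued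
    and preserves the triangle inequality.\<close>
  define B where "B = 1 + (\<Sum>x\<in>pverts G. \<Sum>y\<in>pverts G. \<bar>d x y\<bar>)"
  define D where "D x y = (if R x y then d x y else B)" for x y
  have opt: "\<exists>p. awalk x p y \<and> ereal (awalk_cost c p) = \<mu> c x y \<and> awalk_cost c p = D x y" if "R x y" for x y
    using min_cost_awalk[of x y c] c that by (force simp: R_def D_def d_def apath_def less_imp_le)
  have mu_D: "\<mu> c x y = ereal (D x y)" if "R x y" for x y using opt[OF that] by auto
  have walk_ge: "D x y \<le> awalk_cost c p" if "awalk x p y" for x p y
    using min_cost_le_walk_cost[OF that, of c] mu_D[of x y] reachable_awalkI[OF that] by (simp add: R_def)
  have D_le_B: "D x y < B" if "R x y" "x \<in> pverts G" "y \<in> pverts G" for x y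
  proof -
    have "\<bar>d x y\<bar> \<le> (\<Sum>y\<in>pverts G. \<bar>d x y\<bar>)"
      using that finite_verts by (intro member_le_sum) auto
    also have "\<dots> \<le> (\<Sum>x\<in>pverts G. \<Sum>y\<in>pverts G. \<bar>d x y\<bar>)"
      using that finite_verts by (intro member_le_sum[where f = "\<lambda>x. \<Sum>y\<in>pverts G. \<bar>d x y\<bar>"]) (auto intro: sum_nonneg)
    finally show ?thesis using that by (simp add: D_def B_def)
  qed
  have "1 \<le> B" by (simp add: B_def sum_nonneg)
  have D_nonneg: "0 \<le> D x y" for x y
  proof (cases "R x y")
    case True
    then obtain p where "awalk x p y" "awalk_cost c p = D x y" using opt by blast
    then show ?thesis using pos_cost_pos_awalk_cost[of x p y c] c by (force simp: less_imp_le)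
  qed (use \<open>1 \<le> B\<close> in \<open>simp add: D_def\<close>)
  have R_trans: "R x y \<Longrightarrow> R y z \<Longrightarrow> R x z" for x y z unfolding R_def by (rule reachable_trans)
  have tri: "D x z \<le> D x y + D y z" if V: "x \<in> pverts G" "y \<in> pverts G" "z \<in> pverts G" for x y z
  proof (cases "R x y \<and> R y z")
    case True
    then obtain p q where "awalk x p y" "awalk_cost c p = D x y" "awalk y q z" "awalk_cost c q = D y z"
      using opt by meson
    then show ?thesis using walk_ge[of x "p @ q" z] awalk_appendI by fastforce
  next
    case False
    then have "B \<le> D x y + D y z" using D_nonneg[of x y] D_nonneg[of y z] by (auto simp: D_def)
    moreover have "D x z \<le> B" using D_le_B[of x z] V by (cases "R x z") (auto simp: D_def)
    ultimately show ?thesis by simp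
  qed
  \<comment> \<open>A total below \<open>B\<close> leaves no room for an unreachable leg.\<close>
  have R_btw: "R x y \<and> R y z" if V: "x \<in> pverts G" "y \<in> pverts G" "z \<in> pverts G" "R x z" "D x y + D y z = D x z" for x y z
    using D_le_B[OF V(4,1,3)] V(5) D_nonneg[of x y] D_nonneg[of y z] by (auto simp: D_def split: if_splits)
  \<comment> \<open>Tightness keeps \<open>D x u\<close> below \<open>B\<close>, so \<open>u\<close>
    is reachable and the arc ends a shortest walk. This lets \<open>c_uniq\<close> compare last
    arcs.\<close>
  have extend: "\<exists>p. awalk x (p @ [(u, y)]) y \<and> ereal (awalk_cost c (p @ [(u, y)])) = \<mu> c x y"
    if V: "x \<in> pverts G" "R x y" "(u, y) \<in> parcs G" "D x u + c (u, y) = D x y" for x y u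
  proof -
    have "u \<in> pverts G" "y \<in> pverts G" using V(3) wellformed' by auto
    then have "D x u < B" using D_le_B[OF V(2,1)] V(4) c[OF V(3)] by auto
    then have "R x u" by (auto simp: D_def split: if_splits)
    then obtain p where p: "awalk x p u" "awalk_cost c p = D x u" using opt by blast
    then have "awalk x (p @ [(u, y)]) y" using V(3) wellformed' by (auto simp: awalk_simps)
    then show ?thesis using p V mu_D by (intro exI[of _ p]) auto
  qed
  have ug: "unique_geodesics (pverts G) (parcs G) c D R"
  proof
    show "finite (pverts G)" by (rule finite_verts)
    show "parcs G \<subseteq> pverts G \<times> pverts G" using wellformed' by auto
  next
    fix x assume "x \<in> pverts G"
    then have "awalk x [] x" by (simp add: awalk_Nil_iff)
    then show "D x x = 0" using walk_ge[of x "[]" x] D_nonneg[of x x] by simp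
  next
    fix x y assume V: "x \<in> pverts G" "y \<in> pverts G" "x \<noteq> y"
    show "0 < D x y"
    proof (cases "R x y")
      case True
      then obtain p where p: "awalk x p y" "awalk_cost c p = D x y" using opt by blast
      then obtain e q where "p = e # q" using V(3) by (cases p) (auto simp: awalk_Nil_iff)
      then have "e \<in> parcs G" "awalk (snd e) q y" using p by (auto simp: awalk_Cons_iff)
      then have "0 < c e" "0 \<le> awalk_cost c q" using c D_nonneg[of "snd e" y] walk_ge by (auto intro: order_trans)
      then show ?thesis using p \<open>p = e # q\<close> by simp
    qed (use \<open>1 \<le> B\<close> in \<open>simp add: D_def\<close>)
  next
    fix u v assume "(u, v) \<in> parcs G"
    then show "D u v \<le> c (u, v)" using walk_ge[of u "[(u, v)]" v] wellformed' by (auto simp: awalk_simps)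
  next
    fix s t x y
    assume V: "s \<in> pverts G" "t \<in> pverts G" "R s t" "x \<in> pverts G" "y \<in> pverts G"
      and b: "D s x + D x t = D s t" "D s y + D y t = D s t"
    have split: "\<exists>p q. awalk s p z \<and> awalk z q t \<and> awalk_cost c p = D s z \<and> awalk_cost c q = D z t
        \<and> ereal (awalk_cost c (p @ q)) = \<mu> c s t" if z: "z \<in> pverts G" "D s z + D z t = D s t" for z
    proof -
      obtain p q where "awalk s p z" "awalk z q t" "awalk_cost c p = D s z" "awalk_cost c q = D z t"
        using opt R_btw[OF V(1) z(1) V(2,3) z(2)] by meson
      then show ?thesis using z(2) mu_D[OF V(3)] by (intro exI[of _ p] exI[of _ q]) simp
    qed
    obtain p1 p2 where p: "awalk s p1 x" "awalk x p2 t" "awalk_cost c p1 = D s x" "awalk_cost c p2 = D x t"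
        "ereal (awalk_cost c (p1 @ p2)) = \<mu> c s t" using split[OF V(4) b(1)] by blast
    obtain q1 q2 where q: "awalk s q1 y" "awalk y q2 t" "awalk_cost c q1 = D s y" "awalk_cost c q2 = D y t"
        "ereal (awalk_cost c (q1 @ q2)) = \<mu> c s t" using split[OF V(5) b(2)] by blast
    \<comment> \<open>Both are shortest walks from \<open>s\<close> to \<open>t\<close>, hence
      equal, so one of the prefixes extends the other.\<close>
    have "p1 @ p2 = q1 @ q2"
      using c_uniq[of s "p1 @ p2" t "q1 @ q2"] p q awalk_appendI by blast
    then obtain r where "p1 = q1 @ r \<or> q1 = p1 @ r" by (auto simp: append_eq_append_conv2)
    then show "D s x + D x y = D s y \<or> D s y + D y x = D s x"
    proof
      assume r: "p1 = q1 @ r"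
      then have "awalk y r x" using p(1) awlast_of_awalk[OF q(1)] by simp
      then have "D y x \<le> awalk_cost c r" by (rule walk_ge)
      then show ?thesis using p q r tri[of s x y] tri[of s y x] V by auto
    next
      assume r: "q1 = p1 @ r"
      then have "awalk x r y" using q(1) awlast_of_awalk[OF p(1)] by simp
      then have "D x y \<le> awalk_cost c r" by (rule walk_ge)
      then show ?thesis using p q r tri[of s y x] tri[of s x y] V by auto
    qed
  next
    fix x y assume V: "x \<in> pverts G" "y \<in> pverts G" "R x y" "x \<noteq> y"
    then obtain p where p: "awalk x p y" "awalk_cost c p = D x y" using opt by blast
    then have "p \<noteq> []" using V(4) by (auto simp: awalk_Nil_iff)
    then have "p = butlast p @ [(fst (last p), snd (last p))]" by simp
    then obtain q u y' where pq: "p = q @ [(u, y')]" by blast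
    have "awalk x q u" and uy: "(u, y) \<in> parcs G" "y' = y" using p(1) pq by (auto simp: awalk_simps)
    then have "D x u \<le> awalk_cost c q" by (intro walk_ge)
    moreover have "D x y \<le> D x u + D u y" "D u y \<le> c (u, y)"
      using tri V wellformed'[OF uy(1)] walk_ge[of u "[(u, y)]" y] uy by (auto simp: awalk_simps)
    ultimately show "\<exists>u. (u, y) \<in> parcs G \<and> D x u + c (u, y) = D x y"
      using p pq uy by (intro exI[of _ u]) auto
  next
    fix x y u u' assume h: "x \<in> pverts G" "R x y" "(u, y) \<in> parcs G" "D x u + c (u, y) = D x y"
      "(u', y) \<in> parcs G" "D x u' + c (u', y) = D x y"
    obtain p where p: "awalk x (p @ [(u, y)]) y" "ereal (awalk_cost c (p @ [(u, y)])) = \<mu> c x y"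
      using extend[OF h(1-4)] by blast
    obtain p' where p': "awalk x (p' @ [(u', y)]) y" "ereal (awalk_cost c (p' @ [(u', y)])) = \<mu> c x y"
      using extend[OF h(1,2,5,6)] by blast
    show "u = u'" using c_uniq[OF p(1) p'(1) p(2) p'(2)] by simp
  next
    fix x y z assume "x \<in> pverts G" "y \<in> pverts G" "z \<in> pverts G"
    then show "D x z \<le> D x y + D y z" by (rule tri)
  next
    fix s v t assume "s \<in> pverts G" "v \<in> pverts G" "t \<in> pverts G" "R s t" "D s v + D v t = D s t"
    then show "R s v \<and> R v t" by (rule R_btw)
  qed
  interpret unique_geodesics "pverts G" "parcs G" c D R by (rule ug)
  define H where "H = \<lparr>pverts = pverts G, parcs = \<Union>(geodesic_arcs ` P)\<rparr>"
  have "pverts H = pverts G" by (simp add: H_def)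
  have H_sub: "parcs H \<subseteq> parcs G" by (auto simp: H_def geodesic_arcs_def)
  have wfH: "pair_wf_digraph H"
    by unfold_locales (use H_sub wellformed' in \<open>auto simp: H_def geodesic_arcs_def\<close>)
  then interpret H: pair_wf_digraph H .
  have sub: "subgraph (with_proj H) (with_proj G)"
    using H_sub wfH pair_wf_digraph by (auto simp: subgraph_def compatible_def wf_digraph_wp_iff H_def)
  have "wdist H w s t = wdist G w s t" if st: "(s, t) \<in> P" for s t
  proof (rule antisym)
    have R: "R s t" "s \<in> pverts G" "t \<in> pverts G" using st P by (auto simp: demand_pairs_def R_def)
    obtain p where p: "awalk s p t" "ereal (awalk_cost c p) = \<mu> c s t" "awalk_cost c p = D s t"
      using opt[OF R(1)] by blast
    have "(u, v) \<in> geodesic_arcs (s, t)" if uv: "(u, v) \<in> set p" for u v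
    proof -
      obtain p1 p2 where ps: "p = p1 @ (u, v) # p2" using uv by (metis in_set_conv_decomp)
      then have wk: "awalk s p1 u" "(u, v) \<in> parcs G" "awalk v p2 t" using p(1) by (auto simp: awalk_simps)
      have "D s u \<le> awalk_cost c p1" "D v t \<le> awalk_cost c p2" using wk walk_ge by auto
      moreover have "D s t \<le> D s v + D v t" "D s v \<le> D s u + D u v"
        using tri R wellformed'[OF wk(2)] by auto
      ultimately show ?thesis using p(3) ps wk(2) D_arc[OF wk(2)] by (auto simp: geodesic_arcs_def)
    qed
    then have "set p \<subseteq> parcs H" using st by (auto simp: H_def)
    then have "H.awalk s p t" using p(1) R \<open>pverts H = pverts G\<close> by (simp add: H.awalk_def awalk_def)
    then have "wdist H w s t \<le> awalk_cost w p" unfolding wdist_def by (rule H.min_cost_le_walk_cost)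
    also have "\<dots> = wdist G w s t" using c_w[OF p(1,2)] by (simp add: wdist_def)
    finally show "wdist H w s t \<le> wdist G w s t" .
    show "wdist G w s t \<le> wdist H w s t"
      unfolding wdist_def H.\<mu>_def
      by (rule INF_greatest) (use subgraph_awalk_imp_awalk[OF _ sub] min_cost_le_walk_cost in auto)
  qed
  then have "distance_preserver G w P H" using sub by (auto simp: distance_preserver_def)
  then show ?thesis using that ug unfolding H_def R_def by blast
qed

section \<open>Counting arcs\<close>

context unique_geodesics begin

definition path_arcs :: "(nat \<times> nat) set \<Rightarrow> (nat \<times> nat) set" where
  "path_arcs P = \<Union>(geodesic_arcs ` P)"

text \<open>While some demand geodesic has \<open>l\<close> vertices in \<open>U\<close>, remove
  \<open>l\<close> of them at cost \<open>X\<close>, at most \<open>card U / l\<close> times. Then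
  every demand has fewer than \<open>l\<close> vertices left, each entered by at most one of its
  arcs.\<close>

lemma greedy_arcs_bound:
  assumes P: "P \<subseteq> demands" "finite P" and l: "1 \<le> l"
    and X: "0 \<le> X" "\<And>st Q. st \<in> P \<Longrightarrow> Q \<subseteq> geodesic st \<Longrightarrow> card Q = l \<Longrightarrow>
      real (card {(u, v) \<in> path_arcs P. v \<in> Q}) \<le> X"
  shows "finite U \<Longrightarrow> real (card {(u, v) \<in> path_arcs P. v \<in> U}) \<le> card P * l + card U / l * X"
proof (induction "card U" arbitrary: U rule: less_induct)
  case less
  show ?case
  proof (cases "\<exists>st\<in>P. l \<le> card (U \<inter> geodesic st)")
    case True
    then obtain st Q where Q: "st \<in> P" "Q \<subseteq> U \<inter> geodesic st" "card Q = l"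
      by (meson obtain_subset_with_card_n)
    have "finite Q" using Q less.prems finite_subset by blast
    then have card: "card (U - Q) = card U - l" "l \<le> card U"
      using Q less.prems card_Diff_subset[of Q U] card_mono[of U Q] by auto
    have eq: "{(u, v) \<in> path_arcs P. v \<in> U} = {(u, v) \<in> path_arcs P. v \<in> U - Q} \<union> {(u, v) \<in> path_arcs P. v \<in> Q}"
      using Q by auto
    have "card {(u, v) \<in> path_arcs P. v \<in> U}
        \<le> card {(u, v) \<in> path_arcs P. v \<in> U - Q} + card {(u, v) \<in> path_arcs P. v \<in> Q}"
      by (subst eq) (rule card_Un_le)
    then have "real (card {(u, v) \<in> path_arcs P. v \<in> U})
        \<le> real (card {(u, v) \<in> path_arcs P. v \<in> U - Q}) + real (card {(u, v) \<in> path_arcs P. v \<in> Q})"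
      by linarith
    also have "\<dots> \<le> card P * l + (card (U - Q) / l * X + X)"
      unfolding add.assoc[symmetric]
      using less.hyps[of "U - Q"] X(2)[OF Q(1)] Q card l less.prems by (intro add_mono) auto
    also have "card (U - Q) / l * X + X = card U / l * X"
      using card l by (simp add: of_nat_diff field_simps)
    finally show ?thesis .
  next
    case False
    have "{(u, v) \<in> path_arcs P. v \<in> U} \<subseteq> (\<Union>(st, v)\<in>(SIGMA st:P. U \<inter> geodesic st). {(u, v') \<in> geodesic_arcs st. v' = v})"
    proof
      fix e assume e: "e \<in> {(u, v) \<in> path_arcs P. v \<in> U}"
      obtain u v where uv: "e = (u, v)" by fastforce
      then obtain s t where st: "(s, t) \<in> P" "(u, v) \<in> geodesic_arcs (s, t)" using e by (auto simp: path_arcs_def)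
      then have "v \<in> geodesic (s, t)" using geodesic_arc_heads(3) P by blast
      then have "((s, t), v) \<in> (SIGMA st:P. U \<inter> geodesic st)"
        "e \<in> (case ((s, t), v) of (st, v) \<Rightarrow> {(u, v') \<in> geodesic_arcs st. v' = v})"
        using e uv st by auto
      then show "e \<in> (\<Union>(st, v)\<in>(SIGMA st:P. U \<inter> geodesic st). {(u, v') \<in> geodesic_arcs st. v' = v})"
        by (rule UN_I)
    qed
    moreover have fin: "finite (SIGMA st:P. U \<inter> geodesic st)" using P less.prems by auto
    have "finite (\<Union>(st, v)\<in>(SIGMA st:P. U \<inter> geodesic st). {(u, v') \<in> geodesic_arcs st. v' = v}) \<and>
        card (\<Union>(st, v)\<in>(SIGMA st:P. U \<inter> geodesic st). {(u, v') \<in> geodesic_arcs st. v' = v})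
      \<le> card (SIGMA st:P. U \<inter> geodesic st)"
      by (intro conjI card_UN_le_of_singletons[OF fin]; use geodesic_arc_unique P in fastforce)
    ultimately have "card {(u, v) \<in> path_arcs P. v \<in> U} \<le> card (SIGMA st:P. U \<inter> geodesic st)"
      by (meson card_mono le_trans)
    also have "\<dots> = (\<Sum>st\<in>P. card (U \<inter> geodesic st))"
      using P less.prems by (intro card_SigmaI) auto
    also have "\<dots> \<le> (\<Sum>st\<in>P. l)" using False by (intro sum_mono) (auto simp: not_le less_imp_le)
    finally have "card {(u, v) \<in> path_arcs P. v \<in> U} \<le> card P * l" by simp
    then have "real (card {(u, v) \<in> path_arcs P. v \<in> U}) \<le> real (card P * l)" by (rule of_nat_mono)
    also have "\<dots> \<le> real (card P * l) + card U / l * X" using X(1) by simp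
    finally show ?thesis by simp
  qed
qed

lemma path_arcs_bound:
  assumes P: "P \<subseteq> demands" "finite P" and l: "1 \<le> l"
    and C: "0 \<le> C" and mu: "0 < mu"
    and UDP: "\<And>n p. (n, p) \<in> np_range \<Longrightarrow> real (UDP n p) \<le> C * (real n powr lam * real p powr mu + real n)"
  shows "real (card (path_arcs P)) \<le> card P * l + card V / l * (C * (real l powr lam * real (card P) powr mu + l) + card P + l)"
proof -
  \<comment> \<open>The summands account for jumps, first arcs into \<open>Q\<close> and arcs of the
    base geodesic.\<close>
  define X where "X = C * (real l powr lam * real (card P) powr mu + l) + card P + l"
  have "0 \<le> X" using C by (simp add: X_def)
  have "real (card {(u, v) \<in> path_arcs P. v \<in> Q}) \<le> X"
    if Q: "st \<in> P" "Q \<subseteq> geodesic st" "card Q = l" for st Q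
  proof -
    obtain s0 t0 where st: "st = (s0, t0)" by fastforce
    interpret geodesic_restriction V A c D R s0 t0 Q P
      using Q P st by unfold_locales auto
    have "real (card jumps) \<le> C * (real l powr lam * real (card P) powr mu + l)"
    proof (cases "jumps = {}")
      case False
      then obtain p' where p': "(l, p') \<in> np_range" "p' \<le> card P" "card jumps \<le> UDP l p'"
        using card_jumps_le_UDP Q(3) by metis
      have "real p' powr mu \<le> real (card P) powr mu" using p' mu by (intro powr_mono2) auto
      then have "real (UDP l p') \<le> C * (real l powr lam * real (card P) powr mu + l)"
        using C by (intro order_trans[OF UDP[OF p'(1)]] mult_left_mono add_right_mono) auto
      then show ?thesis using p'(3) by linarith
    qed (use C in simp)
    then show ?thesis
      using card_arcs_into_Q Q(3) unfolding path_arcs_def X_def by linarith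
  qed
  from greedy_arcs_bound[OF P l \<open>0 \<le> X\<close> this finite_V]
  have "real (card {(u, v) \<in> path_arcs P. v \<in> V}) \<le> card P * l + card V / l * X" .
  moreover have "{(u, v) \<in> path_arcs P. v \<in> V} = path_arcs P"
    using arcs_V by (auto simp: path_arcs_def geodesic_arcs_def)
  ultimately show ?thesis by (simp add: X_def)
qed

end

section \<open>The size of a minimum preserver and the balance of terms\<close>

text \<open>A single \<open>m\<close>, the size of the constructed preserver, satisfies the bound
  for all \<open>l\<close>; this allows \<open>l\<close> to be chosen in terms of
  \<open>m\<close>.\<close>

lemma min_directed_preserver_bound:
  assumes G: "directed_instance G w" and P: "demand_pairs G P" and mu: "0 < mu" and C: "0 \<le> C"
    and UDP: "\<And>n p. (n, p) \<in> np_range \<Longrightarrow> real (UDP n p) \<le> C * (real n powr lam * real p powr mu + real n)"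
  obtains m where "min_directed_preserver G w P \<le> m"
    "\<And>l. 1 \<le> l \<Longrightarrow> real m \<le> card P * l
      + card (pverts G) / l * (C * (real l powr lam * real (card P) powr mu + l) + card P + l)"
proof (rule unique_geodesics_exist[OF G P])
  fix c D
  define R where "R x y \<longleftrightarrow> x \<rightarrow>\<^sup>*\<^bsub>with_proj G\<^esub> y" for x y
  assume "unique_geodesics (pverts G) (parcs G) c D (\<lambda>x y. x \<rightarrow>\<^sup>*\<^bsub>with_proj G\<^esub> y)"
  then interpret unique_geodesics "pverts G" "parcs G" c D R by (simp add: R_def[abs_def])
  let ?H = "\<lparr>pverts = pverts G, parcs = path_arcs P\<rparr>"
  assume "distance_preserver G w P \<lparr>pverts = pverts G, parcs = \<Union>(geodesic_arcs ` P)\<rparr>"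
  then have H: "distance_preserver G w P ?H" by (simp add: path_arcs_def)
  have dg: "pair_digraph G" using G by (simp add: directed_instance_def)
  have "min_directed_preserver G w P \<le> card (parcs ?H)"
    unfolding min_directed_preserver_def
    using H by (intro Min_le directed_preserver_sizes(1)[OF dg]) blast
  moreover have "P \<subseteq> demands" using P by (auto simp: demand_pairs_def demands_def R_def)
  moreover have "finite P"
    using P finite_V by (auto simp: demand_pairs_def intro: finite_subset)
  ultimately show ?thesis using that[of "card (path_arcs P)"] path_arcs_bound[OF _ _ _ C mu UDP] by simp
qed

text \<open>The segment length \<open>l\<close> is about \<open>m / (2 p)\<close>, so that the first term is absorbed.\<close>

lemma segment_length_balance:
  fixes lam mu C n p m :: real
  assumes lam: "0 < lam" "lam < 2" and C: "0 \<le> C" and n: "1 \<le> n" and p: "1 \<le> p" and m: "0 \<le> m"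
    and bound: "\<And>l::nat. 1 \<le> l \<Longrightarrow> m \<le> p * l + n / l * (C * (real l powr lam * p powr mu + l) + p + l)"
  shows "m \<le> ((24 * C) powr (1 / (2 - lam)) + 6 * (C + 1) + 5) *
    (n powr (1 / (2 - lam)) * p powr ((1 + mu - lam) / (2 - lam)) + n powr (1 / 2) * p + n)"
proof -
  define a where "a = 1 / (2 - lam)"
  define T1 where "T1 = n powr a * p powr ((1 + mu - lam) / (2 - lam))"
  define T2 where "T2 = n powr (1 / 2) * p"
  have "0 < a" using lam by (simp add: a_def)
  have nn: "0 \<le> T1" "0 \<le> T2" using n p by (auto simp: T1_def T2_def)
  have three_cases: "m \<le> (24 * C) powr a * T1 \<or> m \<le> 6 * (C + 1) * n \<or> m \<le> 5 * T2"
  \<comment> \<open>In this case the length would round down to zero, but \<open>m\<close> is below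
    \<open>2 * T2\<close> anyway.\<close>
  proof (cases "m < 2 * p")
    case True
    have "1 \<le> n powr (1 / 2)" using n by (simp add: ge_one_powr_ge_zero)
    then have "p \<le> T2" using p mult_right_mono[of 1 "n powr (1/2)" p] by (simp add: T2_def)
    then show ?thesis using True p by linarith
  next
    case False
    then have "0 < m" "1 \<le> m / (2 * p)" using p by (auto simp: field_simps)
    define l where "l = nat \<lfloor>m / (2 * p)\<rfloor>"
    \<comment> \<open>Rounding down a number that is at least 1 loses less than a factor 2. The
      upper estimate absorbs \<open>p * l\<close> into \<open>m / 2\<close>, the lower one controls
      \<open>1 / l\<close>.\<close>
    have l: "1 \<le> l" "real l \<le> m / (2 * p)" "m / (4 * p) \<le> real l"
    proof -
      show "1 \<le> l" using \<open>1 \<le> m / (2 * p)\<close> by (simp add: l_def le_nat_iff)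
      have fl: "real l = of_int \<lfloor>m / (2 * p)\<rfloor>" using \<open>1 \<le> m / (2 * p)\<close> by (simp add: l_def)
      then show "real l \<le> m / (2 * p)" by linarith
      have "m / (2 * p) < 2 * real l" using fl \<open>1 \<le> l\<close> by linarith
      then show "m / (4 * p) \<le> real l" using p by (simp add: field_simps)
    qed
    have l0: "0 < real l" using l(1) by simp
    have pl: "p * l \<le> m / 2" using l(2) p by (simp add: field_simps)
    define x where "x = m / p"
    have x0: "0 < x" using \<open>0 < m\<close> p by (simp add: x_def)
    have "real l powr lam \<le> x powr lam"
      using l(2) l0 lam p \<open>0 < m\<close> by (intro powr_mono2) (auto simp: x_def field_simps)
    moreover have "1 / l \<le> 4 / x" using l(3) l0 p \<open>0 < m\<close> by (simp add: x_def field_simps)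
    ultimately have lx: "real l powr lam * (1 / l) \<le> x powr lam * (4 / x)"
      using l0 by (intro mult_mono) auto
    have "m \<le> p * l + n / l * (C * (real l powr lam * p powr mu + l) + p + l)" by (rule bound[OF l(1)])
    also have "n / l * (C * (real l powr lam * p powr mu + l) + p + l)
        = C * n * p powr mu * (real l powr lam * (1 / l)) + (C + 1) * n + n * p * (1 / l)"
      using l0 by (simp add: field_simps)
    also have "\<dots> \<le> C * n * p powr mu * (x powr lam * (4 / x)) + (C + 1) * n + n * p * (4 / x)"
      using lx \<open>1 / l \<le> 4 / x\<close> C n p by (intro add_mono mult_left_mono) auto
    finally have "m \<le> 2 * (C * n * p powr mu * (x powr lam * (4 / x))) + 2 * ((C + 1) * n) + 2 * (n * p * (4 / x))"
      using pl by linarith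
    then have "m \<le> 8 * C * n * p powr mu * x powr lam / x + 2 * (C + 1) * n + 8 * n * p / x"
      by (simp add: mult_ac)
    \<comment> \<open>The largest of three summands is at least \<open>m / 3\<close>; hence the
      constants 24 = 3 * 8 and 6 = 3 * 2.\<close>
    then consider "m \<le> 3 * (8 * C * n * p powr mu * x powr lam / x)" | "m \<le> 3 * (2 * (C + 1) * n)"
      | "m \<le> 3 * (8 * n * p / x)" by linarith
    then show ?thesis
    proof cases
      case 1
      \<comment> \<open>Substituting \<open>x = m / p\<close> gives
        \<open>m powr (2 - lam) <= 24 * C * n * p powr (1 + mu - lam)\<close>. The power
        \<open>a\<close>, positive since \<open>lam < 2\<close>, solves this for
        \<open>m\<close>.\<close>
      have xx: "x powr lam / x = x powr (lam - 1)" using x0 by (simp add: powr_diff)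
      have "m * x powr (1 - lam) \<le> 24 * C * n * p powr mu * (x powr (lam - 1) * x powr (1 - lam))"
      proof -
        have "m \<le> 24 * C * n * p powr mu * x powr (lam - 1)" using 1 by (simp flip: xx)
        then have "m * x powr (1 - lam) \<le> 24 * C * n * p powr mu * x powr (lam - 1) * x powr (1 - lam)"
          by (rule mult_right_mono) simp
        then show ?thesis by (simp add: mult.assoc)
      qed
      also have "x powr (lam - 1) * x powr (1 - lam) = 1" using x0 by (simp flip: powr_add)
      also have "m * x powr (1 - lam) = m powr (2 - lam) * p powr (lam - 1)"
        using \<open>0 < m\<close> p by (simp add: x_def powr_divide powr_diff powr_numeral power2_eq_square field_simps)
      finally have "m powr (2 - lam) * p powr (lam - 1) * p powr (1 - lam) \<le> 24 * C * n * p powr mu * p powr (1 - lam)"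
        by (intro mult_right_mono) auto
      moreover have "p powr (lam - 1) * p powr (1 - lam) = 1" using p by (simp flip: powr_add)
      moreover have "p powr mu * p powr (1 - lam) = p powr (1 + mu - lam)" using p by (simp add: algebra_simps flip: powr_add)
      ultimately have "m powr (2 - lam) \<le> 24 * C * n * p powr (1 + mu - lam)" by (simp add: mult.assoc)
      then have "(m powr (2 - lam)) powr a \<le> (24 * C * n * p powr (1 + mu - lam)) powr a"
        using \<open>0 < a\<close> by (intro powr_mono2) auto
      also have "(m powr (2 - lam)) powr a = m" using lam \<open>0 < m\<close> by (simp add: powr_powr a_def)
      also have "(24 * C * n * p powr (1 + mu - lam)) powr a = (24 * C) powr a * T1"
        using C n p by (simp add: powr_mult powr_powr T1_def a_def mult.assoc)
      finally show ?thesis by simp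
    next
      case 2
      then show ?thesis by (simp add: algebra_simps)
    next
      case 3
      then have "m * m \<le> 24 * n * p * p" using \<open>0 < m\<close> p by (simp add: x_def field_simps)
      \<comment> \<open>24 is rounded up to a square.\<close>
      also have "\<dots> \<le> 25 * (n * p * p)" using n p by simp
      also have "\<dots> = (5 * T2) * (5 * T2)"
      proof -
        have "n powr (1 / 2) * n powr (1 / 2) = n" using n by (simp flip: powr_add)
        then have "T2 * T2 = n * p * p" by (simp add: T2_def mult_ac)
        then show ?thesis by simp
      qed
      finally have "m\<^sup>2 \<le> (5 * T2)\<^sup>2" by (simp add: power2_eq_square)
      then have "m \<le> 5 * T2" by (rule power2_le_imp_le) (use nn(2) in simp)
      then show ?thesis by simp
    qed
  qed
  have "m \<le> (24 * C) powr a * T1 + 6 * (C + 1) * n + 5 * T2"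
  proof -
    have "0 \<le> (24 * C) powr a * T1" "0 \<le> 6 * (C + 1) * n" using nn C n by simp_all
    then show ?thesis using nn(2) three_cases by linarith
  qed
  also have "\<dots> \<le> ((24 * C) powr a + 6 * (C + 1) + 5) * T1 + ((24 * C) powr a + 6 * (C + 1) + 5) * n
      + ((24 * C) powr a + 6 * (C + 1) + 5) * T2"
    using nn C n by (intro add_mono mult_right_mono) auto
  finally show ?thesis by (simp add: T1_def T2_def a_def algebra_simps)
qed

theorem mainTheorem1:
  fixes lam mu :: real
  assumes "0 < lam" and "lam < 2" and "0 < mu"
    and "(\<lambda>(n, p). real (UDP n p)) \<in> O[principal np_range](\<lambda>(n, p).
           real n powr lam * real p powr mu + real n)"
  shows "(\<lambda>(n, p). real (DDP n p)) \<in> O[principal np_range](\<lambda>(n, p).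
           real n powr (1 / (2 - lam)) * real p powr ((1 + mu - lam) / (2 - lam))
           + real n powr (1 / 2) * real p + real n)"
proof -
  \<comment> \<open>On a principal filter big O is one constant valid at every pair of
    \<open>np_range\<close>, small values included.\<close>
  obtain C where C: "0 < C" "\<forall>\<^sub>F np in principal np_range. norm (case np of (n, p) \<Rightarrow> real (UDP n p))
      \<le> C * norm (case np of (n, p) \<Rightarrow> real n powr lam * real p powr mu + real n)"
    using landau_o.bigE[OF assms(4)] by blast
  have UDP: "real (UDP n p) \<le> C * (real n powr lam * real p powr mu + real n)" if "(n, p) \<in> np_range" for n p
    using C(2) that by (force simp: eventually_principal)
  have "real (DDP n p) \<le> ((24 * C) powr (1 / (2 - lam)) + 6 * (C + 1) + 5) *
    (real n powr (1 / (2 - lam)) * real p powr ((1 + mu - lam) / (2 - lam)) + real n powr (1 / 2) * real p + real n)"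
    if np: "(n, p) \<in> np_range" for n p
  proof -
    have "DDP n p \<in> {min_directed_preserver G w P | G w P.
        directed_instance G w \<and> card (pverts G) = n \<and> demand_pairs G P \<and> card P = p}"
      unfolding DDP_def by (rule Max_in[OF DDP_instances(1) DDP_instances(2)[OF np]])
    then obtain G w P where G: "DDP n p = min_directed_preserver G w P" "directed_instance G w"
      "card (pverts G) = n" "demand_pairs G P" "card P = p" by blast
    obtain m where m: "min_directed_preserver G w P \<le> m" "\<And>l. 1 \<le> l \<Longrightarrow> real m \<le> card P * l
      + card (pverts G) / l * (C * (real l powr lam * real (card P) powr mu + l) + card P + l)"
      using min_directed_preserver_bound[OF G(2,4) assms(3) less_imp_le[OF C(1)] UDP] by metis
    have "real (DDP n p) \<le> real m" using m(1) G(1) by simp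
    also have "\<dots> \<le> ((24 * C) powr (1 / (2 - lam)) + 6 * (C + 1) + 5) *
      (real n powr (1 / (2 - lam)) * real p powr ((1 + mu - lam) / (2 - lam)) + real n powr (1 / 2) * real p + real n)"
      using np m(2) G(3,5) C(1) by (intro segment_length_balance[OF assms(1,2)]) (auto simp: np_range_def)
    finally show ?thesis .
  qed
  then show ?thesis
    by (intro bigoI) (auto simp: eventually_principal)
qed

end
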